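(* Suppose $X_1,\dots,X_n$ are independent under a sublinear expectation $\mathbb{E}$ with $$\mathbb{E}[X_i]=-\mathbb{E}[-X_i]=\mu,\quad\mathbb{E}[(X_i-\mu)^2]=\overline{\sigma}_i^2,\quad-\mathbb{E}[-(X_i-\mu)^2]=\underline{\sigma}_i^2,\qquad i=1,\dots,n.$$ Let $Z$ be a standard Gaussian random variable (on a classical probability space with expectation $E$). (1) Let $\overline{B}_n^2=\sum_{i=1}^n\overline{\sigma}_i^2$. For every convex $\varphi\in lip(\mathbb{R})$, $$\Big|\mathbb{E}\Big\{\varphi\Big[\sum_{i=1}^n(X_i-\mu)/\overline{B}_n\Big]\Big\}-E[\varphi(Z)]\Big|\le\frac{\|\varphi'\|}{\overline{B}_n}\sum_{i=1}^n\frac{2\overline{\sigma}_i^3+\mathbb{E}[|X_i-\mu|^3]}{\sum_{j=i}^n\overline{\sigma}_j^2}.$$ (2) Let $\underline{B}_n^2=\sum_{i=1}^n\underline{\sigma}_i^2$. For every concave $\varphi\in lip(\mathbb{R})$, $$\Big|\mathbb{E}\Big\{\varphi\Big[\sum_{i=1}^n(X_i-\mu)/\underline{B}_n\Big]\Big\}-E[\varphi(Z)]\Big|\le\frac{\|\varphi'\|}{\underline{B}_n}\sum_{i=1}^n\frac{2\underline{\sigma}_i^2\overline{\sigma}_i+\mathbb{E}[|X_i-\mu|^3]}{\sum_{j=i}^n\underline{\sigma}_j^2}.$$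
   Context: Let $\{P_\theta:\theta\in\Theta\}$ be a set of probability measures on a measurable space $(\Omega,\mathcal{F})$, and let $E_\theta$ be the expectation under $P_\theta$. For a random variable $X$ such that $E_\theta[X]$ exists for all $\theta\in\Theta$, the sublinear expectation is $\mathbb{E}[X]:=\sup_{\theta\in\Theta}E_\theta[X]$. A random vector $Y\in\mathbb{R}^k$ is independent of a random vector $X\in\mathbb{R}^l$ if $\mathbb{E}[\varphi(X,Y)]=\mathbb{E}\big\{\{\mathbb{E}[\varphi(x,Y)]\}_{x=X}\big\}$ for all bounded continuous $\varphi:\mathbb{R}^{l+k}\to\mathbb{R}$ (this relation is not symmetric). That $X_1,\dots,X_n$ are independent means that $X_{i+1}$ is independent of $(X_1,\dots,X_i)$ for each $i=1,\dots,n-1$. $lip(\mathbb{R})$ is the class of Lipschitz functions on $\mathbb{R}$, and $\|\cdot\|$ is the supremum norm ($\|\varphi'\|$ is the Lipschitz constant of $\varphi$). $\overline{\sigma}_i,\underline{\sigma}_i,\overline{B}_n,\underline{B}_n$ are the nonnegative square roots. *)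

theory Defs
  imports "HOL-Probability.Probability"
begin

text \<open>
  The classical expectation is taken in the extended sense, so that a nonnegative variable
  always has one, possibly infinite.  In the case where it does not exist the value is
  infinity minus infinity, i.e. infinity in \<^typ>\<open>ereal\<close>; hence finiteness of the sublinear
  expectation of both \<open>X\<close> and \<open>- X\<close> forces existence (and finiteness) under every \<open>P \<theta>\<close>.
\<close>
definition ext_expectation :: "'a measure \<Rightarrow> ('a \<Rightarrow> real) \<Rightarrow> ereal" where
  "ext_expectation M X =
     enn2ereal (\<integral>\<^sup>+\<omega>. ennreal (X \<omega>) \<partial>M) - enn2ereal (\<integral>\<^sup>+\<omega>. ennreal (- X \<omega>) \<partial>M)"

definition sublin_expectation ::
  "('t \<Rightarrow> 'a measure) \<Rightarrow> 't set \<Rightarrow> ('a \<Rightarrow> real) \<Rightarrow> ereal" where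
  "sublin_expectation P \<Theta> X = (SUP \<theta>\<in>\<Theta>. ext_expectation (P \<theta>) X)"

text \<open>
  Vectors in \<open>\<real>\<^sup>l\<close> are points of \<^term>\<open>Euclidean_space l\<close>: functions on \<^typ>\<open>nat\<close> that vanish
  from index \<open>l\<close> on.  If \<open>x \<in> \<real>\<^sup>l\<close> and \<open>y \<in> \<real>\<^sup>k\<close>, then \<open>vec_append l x y\<close> is \<open>(x, y) \<in> \<real>\<^bsup>l+k\<^esup>\<close>.
\<close>
definition vec_append :: "nat \<Rightarrow> (nat \<Rightarrow> real) \<Rightarrow> (nat \<Rightarrow> real) \<Rightarrow> (nat \<Rightarrow> real)" where
  "vec_append l x y = (\<lambda>j. if j < l then x j else y (j - l))"

text \<open>\<open>segment_vec X a k\<close> is the random vector \<open>(X\<^sub>a, \<dots>, X\<^bsub>a+k-1\<^esub>)\<close> in \<open>\<real>\<^sup>k\<close>.\<close>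
definition segment_vec :: "(nat \<Rightarrow> 'a \<Rightarrow> real) \<Rightarrow> nat \<Rightarrow> nat \<Rightarrow> 'a \<Rightarrow> (nat \<Rightarrow> real)" where
  "segment_vec X a k \<omega> = (\<lambda>j. if j < k then X (a + j) \<omega> else 0)"

text \<open>
  \<open>indep_of P \<Theta> k Y l X\<close>: the random vector \<open>Y\<close> in \<open>\<real>\<^sup>k\<close> is independent of the random vector
  \<open>X\<close> in \<open>\<real>\<^sup>l\<close> (in this order).  The inner sublinear expectation is finite, since \<open>\<phi>\<close> is
  bounded, so \<^const>\<open>real_of_ereal\<close> loses nothing there.
\<close>
definition indep_of ::
  "('t \<Rightarrow> 'a measure) \<Rightarrow> 't set \<Rightarrow> nat \<Rightarrow> ('a \<Rightarrow> nat \<Rightarrow> real) \<Rightarrow> nat \<Rightarrow> ('a \<Rightarrow> nat \<Rightarrow> real) \<Rightarrow> bool"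
  where
  "indep_of P \<Theta> k Y l X \<longleftrightarrow>
     (\<forall>\<phi>. continuous_map (Euclidean_space (l + k)) euclideanreal \<phi> \<and>
          bounded (\<phi> ` topspace (Euclidean_space (l + k))) \<longrightarrow>
        sublin_expectation P \<Theta> (\<lambda>\<omega>. \<phi> (vec_append l (X \<omega>) (Y \<omega>))) =
        sublin_expectation P \<Theta> (\<lambda>\<omega>. real_of_ereal
          (sublin_expectation P \<Theta> (\<lambda>\<omega>'. \<phi> (vec_append l (X \<omega>) (Y \<omega>'))))))"

definition indep_seq ::
  "('t \<Rightarrow> 'a measure) \<Rightarrow> 't set \<Rightarrow> nat \<Rightarrow> (nat \<Rightarrow> 'a \<Rightarrow> real) \<Rightarrow> bool" where
  "indep_seq P \<Theta> n X \<longleftrightarrow>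
     (\<forall>i. 1 \<le> i \<and> i < n \<longrightarrow>
        indep_of P \<Theta> 1 (segment_vec X (i + 1) 1) i (segment_vec X 1 i))"

definition lip :: "(real \<Rightarrow> real) set" where
  "lip = {\<phi>. \<exists>L. L-lipschitz_on UNIV \<phi>}"

definition lip_const :: "(real \<Rightarrow> real) \<Rightarrow> real" where
  "lip_const \<phi> = Inf {L. L-lipschitz_on UNIV \<phi>}"

end

theory Submission
  imports Defs
begin

text \<open>
  Lindeberg's replacement argument, with the heat flow in place of Gaussian replacements.  Let
  \<open>u\<^sub>i\<close> be \<open>x \<mapsto> \<phi> (x / B)\<close> smoothed by a centred Gaussian of variance \<open>v\<^sub>i = \<Sum>j>i. c\<^sub>j\<^sup>2\<close>, where
  \<open>c\<^sub>j\<close> is the upper (convex case) or lower (concave case) deviation of \<open>X\<^sub>j\<close>.  Independence and the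
  semigroup property reduce the claim to comparing \<open>u\<^sub>i\<close> averaged over \<open>x + X\<^sub>i - \<mu>\<close> with \<open>u\<^sub>i\<close>
  averaged over \<open>x + c\<^sub>i * Z\<close>.  Smoothing preserves convexity, so the sign of \<open>u\<^sub>i''\<close> is known and
  the sublinear expectation of the quadratic Taylor term uses exactly the variance \<open>c\<^sub>i\<^sup>2\<close>; the two
  cubic remainders are controlled because \<open>u\<^sub>i''\<close> has Lipschitz constant at most
  \<open>2 * L / v\<^sub>i\<close>, with \<open>L\<close> the Lipschitz constant of \<open>x \<mapsto> \<phi> (x / B)\<close>.
\<close>

subsection \<open>Sublinear expectations\<close>

text \<open>Independence is asymmetric: the newest variable may be averaged with the past frozen,
  not conversely. Hence it is always the last remaining summand that is replaced, and the smoothing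
  already present at stage \<open>i\<close> is that of the later variances; adding the variance of
  \<open>X i\<close> itself gives the tail sums from \<open>i\<close> on that stand in the
  denominators. Since the Gaussian side is a deterministic function of the partial sum, no Gaussian
  variable has to be adjoined to the sublinear space.

  The obstacle to a Taylor expansion is that the variance of \<open>X i\<close> varies with
  \<theta>: the sublinear expectation of k times a square selects the upper variance for k \<ge> 0
  and the lower one for k \<le> 0. A sign of the second derivative that is the same at all points
  fixes this choice once and for all, and this is where convexity or concavity enters.

  A second obstacle sits at the end of the sum: there the smoothing variance may be 0, the function
  is merely Lipschitz, and a first-order estimate has to do.\<close>

locale sublinear_expectation_space =
  fixes M :: "'a measure" and P :: "'t \<Rightarrow> 'a measure" and \<Theta> :: "'t set"
  assumes nonempty: "\<Theta> \<noteq> {}"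
    and prob: "\<And>\<theta>. \<theta> \<in> \<Theta> \<Longrightarrow> prob_space (P \<theta>)"
    and sets_P: "\<And>\<theta>. \<theta> \<in> \<Theta> \<Longrightarrow> sets (P \<theta>) = sets M"
begin

text \<open>Integrability under each \<open>P \<theta>\<close> alone would let the means be
  unbounded over \<open>\<Theta>\<close>, and the real supremum \<open>E\<close> would then be
  meaningless. The common bound \<open>C\<close> excludes this and survives linear
  operations.\<close>

definition L1 :: "('a \<Rightarrow> real) set" where
  "L1 = {X \<in> borel_measurable M.
     \<exists>C. \<forall>\<theta>\<in>\<Theta>. integrable (P \<theta>) X \<and> (\<integral>\<omega>. \<bar>X \<omega>\<bar> \<partial>P \<theta>) \<le> C}"

definition E :: "('a \<Rightarrow> real) \<Rightarrow> real" where
  "E X = (SUP \<theta>\<in>\<Theta>. \<integral>\<omega>. X \<omega> \<partial>P \<theta>)"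

lemma measurable_P: "\<theta> \<in> \<Theta> \<Longrightarrow> borel_measurable (P \<theta>) = borel_measurable M"
  by (rule measurable_cong_sets) (simp_all add: sets_P)

lemma L1_measurable: "X \<in> L1 \<Longrightarrow> X \<in> borel_measurable M"
  by (simp add: L1_def)

lemma L1_integrable: "X \<in> L1 \<Longrightarrow> \<theta> \<in> \<Theta> \<Longrightarrow> integrable (P \<theta>) X"
  by (auto simp: L1_def)

lemma L1_const: "(\<lambda>\<omega>. c) \<in> L1"
  using prob by (auto simp: L1_def prob_space.prob_space intro!: exI[of _ "\<bar>c\<bar>"]
    finite_measure.integrable_const prob_space.finite_measure)

lemma L1_mono:
  assumes Y: "Y \<in> L1" and X: "X \<in> borel_measurable M" and le: "\<And>\<omega>. \<bar>X \<omega>\<bar> \<le> \<bar>Y \<omega>\<bar>"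
  shows "X \<in> L1"
proof -
  obtain C where C: "\<forall>\<theta>\<in>\<Theta>. integrable (P \<theta>) Y \<and> (\<integral>\<omega>. \<bar>Y \<omega>\<bar> \<partial>P \<theta>) \<le> C"
    using Y by (auto simp: L1_def)
  have "integrable (P \<theta>) X \<and> (\<integral>\<omega>. \<bar>X \<omega>\<bar> \<partial>P \<theta>) \<le> C" if t: "\<theta> \<in> \<Theta>" for \<theta>
  proof
    have Yi: "integrable (P \<theta>) Y" using C t by auto
    show Xi: "integrable (P \<theta>) X"
      by (rule Bochner_Integration.integrable_bound[OF Yi]) (use X measurable_P[OF t] le in auto)
    have "(\<integral>\<omega>. \<bar>X \<omega>\<bar> \<partial>P \<theta>) \<le> (\<integral>\<omega>. \<bar>Y \<omega>\<bar> \<partial>P \<theta>)"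
      by (rule integral_mono) (use Xi Yi le in auto)
    then show "(\<integral>\<omega>. \<bar>X \<omega>\<bar> \<partial>P \<theta>) \<le> C" using C t by force
  qed
  then show ?thesis using X by (auto simp: L1_def)
qed

lemma L1_add:
  assumes "X \<in> L1" "Y \<in> L1" shows "(\<lambda>\<omega>. X \<omega> + Y \<omega>) \<in> L1"
proof -
  obtain C D where C: "\<forall>\<theta>\<in>\<Theta>. integrable (P \<theta>) X \<and> (\<integral>\<omega>. \<bar>X \<omega>\<bar> \<partial>P \<theta>) \<le> C"
    and D: "\<forall>\<theta>\<in>\<Theta>. integrable (P \<theta>) Y \<and> (\<integral>\<omega>. \<bar>Y \<omega>\<bar> \<partial>P \<theta>) \<le> D"
    using assms by (auto simp: L1_def)
  have "(\<integral>\<omega>. \<bar>X \<omega> + Y \<omega>\<bar> \<partial>P \<theta>) \<le> C + D" if t: "\<theta> \<in> \<Theta>" for \<theta>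
  proof -
    have i: "integrable (P \<theta>) X" "integrable (P \<theta>) Y" using C D t by auto
    have "(\<integral>\<omega>. \<bar>X \<omega> + Y \<omega>\<bar> \<partial>P \<theta>) \<le> (\<integral>\<omega>. \<bar>X \<omega>\<bar> + \<bar>Y \<omega>\<bar> \<partial>P \<theta>)"
      using i by (intro integral_mono abs_triangle_ineq) simp_all
    also have "\<dots> = (\<integral>\<omega>. \<bar>X \<omega>\<bar> \<partial>P \<theta>) + (\<integral>\<omega>. \<bar>Y \<omega>\<bar> \<partial>P \<theta>)"
      using i by simp
    finally show ?thesis using C D t by force
  qed
  moreover have "(\<lambda>\<omega>. X \<omega> + Y \<omega>) \<in> borel_measurable M"
    using assms[THEN L1_measurable] by (rule borel_measurable_add)
  ultimately show ?thesis using C D unfolding L1_def by (auto intro!: exI[of _ "C + D"])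
qed

lemma L1_cmult:
  assumes "X \<in> L1" shows "(\<lambda>\<omega>. c * X \<omega>) \<in> L1"
proof -
  obtain C where C: "\<forall>\<theta>\<in>\<Theta>. integrable (P \<theta>) X \<and> (\<integral>\<omega>. \<bar>X \<omega>\<bar> \<partial>P \<theta>) \<le> C"
    using assms by (auto simp: L1_def)
  have "(\<integral>\<omega>. \<bar>c * X \<omega>\<bar> \<partial>P \<theta>) \<le> \<bar>c\<bar> * C" if "\<theta> \<in> \<Theta>" for \<theta>
    using C that by (auto simp: abs_mult intro!: mult_left_mono)
  then show ?thesis using C L1_measurable[OF assms] unfolding L1_def
    by (auto intro!: exI[of _ "\<bar>c\<bar> * C"])
qed

lemma L1_uminus: "X \<in> L1 \<Longrightarrow> (\<lambda>\<omega>. - X \<omega>) \<in> L1"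
  using L1_cmult[of X "-1"] by simp

lemma L1_diff: "X \<in> L1 \<Longrightarrow> Y \<in> L1 \<Longrightarrow> (\<lambda>\<omega>. X \<omega> - Y \<omega>) \<in> L1"
  using L1_add[OF _ L1_uminus, of X Y] by simp

lemma L1_abs: "X \<in> L1 \<Longrightarrow> (\<lambda>\<omega>. \<bar>X \<omega>\<bar>) \<in> L1"
  by (rule L1_mono) (auto dest: L1_measurable)

lemmas L1_intros = L1_const L1_add L1_cmult L1_uminus L1_diff L1_abs

lemma bdd_E: assumes "X \<in> L1" shows "bdd_above ((\<lambda>\<theta>. \<integral>\<omega>. X \<omega> \<partial>P \<theta>) ` \<Theta>)"
proof -
  obtain C where C: "\<forall>\<theta>\<in>\<Theta>. integrable (P \<theta>) X \<and> (\<integral>\<omega>. \<bar>X \<omega>\<bar> \<partial>P \<theta>) \<le> C"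
    using assms by (auto simp: L1_def)
  have "(\<integral>\<omega>. X \<omega> \<partial>P \<theta>) \<le> C" if "\<theta> \<in> \<Theta>" for \<theta>
    using C that integral_abs_bound[of "P \<theta>" X] by (meson abs_le_D1 order_trans)
  then show ?thesis by (intro bdd_aboveI[of _ C]) auto
qed

lemma E_upper: "X \<in> L1 \<Longrightarrow> \<theta> \<in> \<Theta> \<Longrightarrow> (\<integral>\<omega>. X \<omega> \<partial>P \<theta>) \<le> E X"
  unfolding E_def by (rule cSUP_upper[OF _ bdd_E])

lemma E_least: "(\<And>\<theta>. \<theta> \<in> \<Theta> \<Longrightarrow> (\<integral>\<omega>. X \<omega> \<partial>P \<theta>) \<le> c) \<Longrightarrow> E X \<le> c"
  unfolding E_def using nonempty by (rule cSUP_least)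

lemma ext_expectation_integrable:
  assumes "integrable N X"
  shows "ext_expectation N X = ereal (\<integral>\<omega>. X \<omega> \<partial>N)"
proof -
  have fin: "(\<integral>\<^sup>+\<omega>. ennreal (X \<omega>) \<partial>N) < \<top>" "(\<integral>\<^sup>+\<omega>. ennreal (- X \<omega>) \<partial>N) < \<top>"
    using assms by (auto simp: real_integrable_def less_top)
  have "enn2ereal x = ereal (enn2real x)" if "x < \<top>" for x
    using that by (metis enn2ereal_ennreal enn2real_nonneg ennreal_enn2real)
  then show ?thesis
    using fin real_lebesgue_integral_def[OF assms] unfolding ext_expectation_def by simp
qed

text \<open>The passage from the extended-real notion to \<open>E\<close>: a single \<theta> bounds
  the supremum from below and \<open>E X\<close> bounds it from above, so it is finite and may be
  taken in the reals.\<close>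

lemma sublin_expectation_L1:
  assumes "X \<in> L1" shows "sublin_expectation P \<Theta> X = ereal (E X)"
proof -
  have eq: "sublin_expectation P \<Theta> X = (SUP \<theta>\<in>\<Theta>. ereal (\<integral>\<omega>. X \<omega> \<partial>P \<theta>))"
    unfolding sublin_expectation_def
    by (intro SUP_cong) (auto intro!: ext_expectation_integrable L1_integrable assms)
  obtain t where t: "t \<in> \<Theta>" using nonempty by auto
  have "ereal (\<integral>\<omega>. X \<omega> \<partial>P t) \<le> (SUP \<theta>\<in>\<Theta>. ereal (\<integral>\<omega>. X \<omega> \<partial>P \<theta>))"
    using t by (rule SUP_upper)
  moreover have "(SUP \<theta>\<in>\<Theta>. ereal (\<integral>\<omega>. X \<omega> \<partial>P \<theta>)) \<le> ereal (E X)"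
    by (rule SUP_least) (simp add: E_upper assms)
  ultimately have "\<bar>SUP \<theta>\<in>\<Theta>. ereal (\<integral>\<omega>. X \<omega> \<partial>P \<theta>)\<bar> \<noteq> \<infinity>"
    by (cases "SUP \<theta>\<in>\<Theta>. ereal (\<integral>\<omega>. X \<omega> \<partial>P \<theta>)") auto
  from ereal_SUP[OF this] eq show ?thesis by (simp add: E_def)
qed

text \<open>The negative part contributes 0, so a finite supremum bounds all the integrals at once.
  This is how integrability is extracted from hypotheses on second and third moments.\<close>

lemma L1_nonneg:
  assumes X: "X \<in> borel_measurable M" and nn: "\<And>\<omega>. 0 \<le> X \<omega>"
    and fin: "sublin_expectation P \<Theta> X \<noteq> \<infinity>"
  shows "X \<in> L1"
proof -
  have *: "enn2ereal (\<integral>\<^sup>+\<omega>. ennreal (X \<omega>) \<partial>P \<theta>) \<le> sublin_expectation P \<Theta> X" if t: "\<theta> \<in> \<Theta>" for \<theta>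
  proof -
    have "ext_expectation (P \<theta>) X = enn2ereal (\<integral>\<^sup>+\<omega>. ennreal (X \<omega>) \<partial>P \<theta>)"
      using nn by (simp add: ext_expectation_def ennreal_neg zero_ennreal.rep_eq)
    then show ?thesis unfolding sublin_expectation_def using t by (metis SUP_upper)
  qed
  obtain t where t: "t \<in> \<Theta>" using nonempty by auto
  have "0 \<le> sublin_expectation P \<Theta> X"
    using *[OF t] enn2ereal_nonneg order_trans by blast
  then obtain r where r: "sublin_expectation P \<Theta> X = ereal r"
    using fin by (cases "sublin_expectation P \<Theta> X") auto
  have "integrable (P \<theta>) X \<and> (\<integral>\<omega>. \<bar>X \<omega>\<bar> \<partial>P \<theta>) \<le> r" if t: "\<theta> \<in> \<Theta>" for \<theta>
  proof
    have le: "enn2ereal (\<integral>\<^sup>+\<omega>. ennreal (X \<omega>) \<partial>P \<theta>) \<le> ereal r" using *[OF t] r by simp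
    have r0: "0 \<le> r" using \<open>0 \<le> sublin_expectation P \<Theta> X\<close> r by simp
    have le': "(\<integral>\<^sup>+\<omega>. ennreal (X \<omega>) \<partial>P \<theta>) \<le> ennreal r"
      using le r0 by (simp add: less_eq_ennreal.rep_eq)
    show i: "integrable (P \<theta>) X"
      by (rule integrableI_nonneg)
        (use X measurable_P[OF t] nn le' in \<open>auto intro: le_less_trans\<close>)
    have "ennreal (\<integral>\<omega>. X \<omega> \<partial>P \<theta>) \<le> ennreal r"
      using nn_integral_eq_integral[OF i] nn le' by simp
    then show "(\<integral>\<omega>. \<bar>X \<omega>\<bar> \<partial>P \<theta>) \<le> r" using nn r0 by simp
  qed
  then show ?thesis using X by (auto simp: L1_def)
qed

lemma E_mono:
  assumes "X \<in> L1" "Y \<in> L1" "\<And>\<omega>. X \<omega> \<le> Y \<omega>" shows "E X \<le> E Y"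
proof (rule E_least)
  fix \<theta> assume t: "\<theta> \<in> \<Theta>"
  have "(\<integral>\<omega>. X \<omega> \<partial>P \<theta>) \<le> (\<integral>\<omega>. Y \<omega> \<partial>P \<theta>)"
    by (rule integral_mono) (use assms t L1_integrable in auto)
  with E_upper[OF assms(2) t] show "(\<integral>\<omega>. X \<omega> \<partial>P \<theta>) \<le> E Y" by simp
qed

lemma E_add_le:
  assumes "X \<in> L1" "Y \<in> L1" shows "E (\<lambda>\<omega>. X \<omega> + Y \<omega>) \<le> E X + E Y"
  by (rule E_least) (auto simp: L1_integrable assms intro!: add_mono E_upper)

lemma E_const: "E (\<lambda>\<omega>. c) = c"
proof -
  have "E (\<lambda>\<omega>. c) = (SUP \<theta>\<in>\<Theta>. c)" unfolding E_def
    by (intro SUP_cong) (simp_all add: prob prob_space.prob_space)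
  then show ?thesis using nonempty by simp
qed

lemma E_cmult:
  assumes X: "X \<in> L1" and c: "0 \<le> c" shows "E (\<lambda>\<omega>. c * X \<omega>) = c * E X"
proof (cases "c = 0")
  case True then show ?thesis by (simp add: E_const)
next
  case False
  then have c: "0 < c" using c by simp
  show ?thesis
  proof (rule antisym)
    show "E (\<lambda>\<omega>. c * X \<omega>) \<le> c * E X"
      using c by (intro E_least) (simp add: E_upper X)
    have "E X \<le> E (\<lambda>\<omega>. c * X \<omega>) / c"
      using c E_upper[OF L1_cmult[OF X, of c]] by (intro E_least) (simp add: field_simps)
    then show "c * E X \<le> E (\<lambda>\<omega>. c * X \<omega>)" using c by (simp add: field_simps)
  qed
qed

text \<open>Sublinearity gives only one inequality; equality holds because one summand has no mean
  uncertainty. In the Taylor expansion that summand is the affine part.\<close>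

lemma E_add_certain:
  assumes X: "X \<in> L1" and Y: "Y \<in> L1" and m: "\<And>\<theta>. \<theta> \<in> \<Theta> \<Longrightarrow> (\<integral>\<omega>. X \<omega> \<partial>P \<theta>) = m"
  shows "E (\<lambda>\<omega>. X \<omega> + Y \<omega>) = m + E Y"
proof (rule antisym)
  show "E (\<lambda>\<omega>. X \<omega> + Y \<omega>) \<le> m + E Y"
    using m E_upper[OF Y] by (intro E_least) (simp add: L1_integrable X Y)
  have "E Y \<le> E (\<lambda>\<omega>. X \<omega> + Y \<omega>) - m"
    using m E_upper[OF L1_add[OF X Y]] by (intro E_least) (simp add: L1_integrable X Y field_simps)
  then show "m + E Y \<le> E (\<lambda>\<omega>. X \<omega> + Y \<omega>)" by simp
qed

text \<open>Stands in for linearity: \<open>E X - E Y\<close> need not be \<open>E\<close> of the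
  difference, but a pointwise majorant of the difference controls it in both directions.\<close>

lemma E_dist:
  assumes "X \<in> L1" "Y \<in> L1" "W \<in> L1" and le: "\<And>\<omega>. \<bar>X \<omega> - Y \<omega>\<bar> \<le> W \<omega>"
  shows "\<bar>E X - E Y\<bar> \<le> E W"
proof -
  have "X \<omega> \<le> Y \<omega> + W \<omega>" "Y \<omega> \<le> X \<omega> + W \<omega>" for \<omega> using le[of \<omega>] by linarith+
  then have "E X \<le> E (\<lambda>\<omega>. Y \<omega> + W \<omega>)" "E Y \<le> E (\<lambda>\<omega>. X \<omega> + W \<omega>)"
    using assms(1-3) by (intro E_mono L1_add; simp)+
  then show ?thesis
    using E_add_le[OF assms(1,3)] E_add_le[OF assms(2,3)] by linarith
qed

lemma L2_L1:
  assumes X: "X \<in> borel_measurable M" and X2: "(\<lambda>\<omega>. (X \<omega>)\<^sup>2) \<in> L1" shows "X \<in> L1"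
proof (rule L1_mono[OF _ X])
  show "(\<lambda>\<omega>. 1 + (X \<omega>)\<^sup>2) \<in> L1" using X2 by (intro L1_add L1_const)
  fix \<omega>
  have "0 \<le> (\<bar>X \<omega>\<bar> - 1)\<^sup>2" by simp
  then have "2 * \<bar>X \<omega>\<bar> \<le> 1 + (X \<omega>)\<^sup>2" by (simp only: power2_diff) simp
  then show "\<bar>X \<omega>\<bar> \<le> \<bar>1 + (X \<omega>)\<^sup>2\<bar>" using abs_ge_zero[of "X \<omega>"] by linarith
qed

lemma L2_add:
  assumes X: "X \<in> borel_measurable M" "(\<lambda>\<omega>. (X \<omega>)\<^sup>2) \<in> L1"
    and Y: "Y \<in> borel_measurable M" "(\<lambda>\<omega>. (Y \<omega>)\<^sup>2) \<in> L1"
  shows "(\<lambda>\<omega>. (X \<omega> + Y \<omega>)\<^sup>2) \<in> L1"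
proof (rule L1_mono)
  show "(\<lambda>\<omega>. 2 * (X \<omega>)\<^sup>2 + 2 * (Y \<omega>)\<^sup>2) \<in> L1" using assms by (intro L1_intros)
  show "(\<lambda>\<omega>. (X \<omega> + Y \<omega>)\<^sup>2) \<in> borel_measurable M" using X Y by measurable
  show "\<bar>(X \<omega> + Y \<omega>)\<^sup>2\<bar> \<le> \<bar>2 * (X \<omega>)\<^sup>2 + 2 * (Y \<omega>)\<^sup>2\<bar>" for \<omega>
    using sum_squares_bound[of "X \<omega>" "Y \<omega>"] by (simp add: abs_of_nonneg) (simp add: power2_sum)
qed

text \<open>Linear growth of \<open>g\<close> against a finite second moment. The square is included
  because the truncation error is measured by it.\<close>

lemma lipschitz_L1:
  assumes g: "L-lipschitz_on UNIV g" and X: "X \<in> borel_measurable M" "(\<lambda>\<omega>. (X \<omega>)\<^sup>2) \<in> L1"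
  shows "(\<lambda>\<omega>. (g (X \<omega>))\<^sup>2) \<in> L1" "(\<lambda>\<omega>. g (X \<omega>)) \<in> L1" "(\<lambda>\<omega>. g (X \<omega>)) \<in> borel_measurable M"
proof -
  have L: "0 \<le> L" by (rule lipschitz_on_nonneg[OF g])
  have gm: "g \<in> borel_measurable borel"
    by (rule borel_measurable_continuous_onI[OF lipschitz_on_continuous_on[OF g]])
  show m: "(\<lambda>\<omega>. g (X \<omega>)) \<in> borel_measurable M" using X(1) gm by measurable
  show sq: "(\<lambda>\<omega>. (g (X \<omega>))\<^sup>2) \<in> L1"
  proof (rule L1_mono)
    show "(\<lambda>\<omega>. 2 * (g 0)\<^sup>2 + 2 * L\<^sup>2 * (X \<omega>)\<^sup>2) \<in> L1" using X(2) by (intro L1_intros)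
    show "(\<lambda>\<omega>. (g (X \<omega>))\<^sup>2) \<in> borel_measurable M" using m by measurable
    fix \<omega>
    have "\<bar>g (X \<omega>) - g 0\<bar> \<le> L * \<bar>X \<omega>\<bar>"
      using lipschitz_onD[OF g, of "X \<omega>" 0] by (simp add: dist_real_def)
    then have "(g (X \<omega>) - g 0)\<^sup>2 \<le> L\<^sup>2 * (X \<omega>)\<^sup>2"
      using power_mono[of "\<bar>g (X \<omega>) - g 0\<bar>" "L * \<bar>X \<omega>\<bar>" 2] by (simp add: power_mult_distrib)
    moreover have "(g (X \<omega>))\<^sup>2 \<le> 2 * (g 0)\<^sup>2 + 2 * (g (X \<omega>) - g 0)\<^sup>2"
      using sum_squares_bound[of "g 0" "g (X \<omega>) - g 0"] zero_le_power2[of "g (X \<omega>) - 2 * g 0"]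
      by (simp add: power2_eq_square algebra_simps)
    ultimately show "\<bar>(g (X \<omega>))\<^sup>2\<bar> \<le> \<bar>2 * (g 0)\<^sup>2 + 2 * L\<^sup>2 * (X \<omega>)\<^sup>2\<bar>"
      by (simp add: mult.assoc)
  qed
  show "(\<lambda>\<omega>. g (X \<omega>)) \<in> L1" by (rule L2_L1[OF m sq])
qed

text \<open>Separating \<open>w\<close> from \<open>y\<close> gives a majorant quadratic in
  \<open>w\<close>, which stays in \<open>L1\<close> when a partial sum is substituted for
  \<open>w\<close>.\<close>

lemma lipschitz_shift_sq:
  assumes g: "L-lipschitz_on UNIV g"
  shows "(g (w + y))\<^sup>2 \<le> 3 * (g 0)\<^sup>2 + 3 * L\<^sup>2 * w\<^sup>2 + 3 * L\<^sup>2 * y\<^sup>2"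
proof -
  have L: "0 \<le> L" by (rule lipschitz_on_nonneg[OF g])
  have "\<bar>g (w + y) - g 0\<bar> \<le> L * \<bar>w + y\<bar>"
    using lipschitz_onD[OF g, of "w + y" 0] by (simp add: dist_real_def)
  also have "\<dots> \<le> L * \<bar>w\<bar> + L * \<bar>y\<bar>"
    using L by (metis abs_triangle_ineq distrib_left mult_left_mono)
  finally have "\<bar>g (w + y)\<bar> \<le> \<bar>g 0\<bar> + L * \<bar>w\<bar> + L * \<bar>y\<bar>" by linarith
  then have "(g (w + y))\<^sup>2 \<le> (\<bar>g 0\<bar> + L * \<bar>w\<bar> + L * \<bar>y\<bar>)\<^sup>2"
    using abs_le_square_iff by (metis abs_ge_self order_trans)
  also have "\<dots> \<le> 3 * (\<bar>g 0\<bar>\<^sup>2 + (L * \<bar>w\<bar>)\<^sup>2 + (L * \<bar>y\<bar>)\<^sup>2)"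
    using zero_le_power2[of "\<bar>g 0\<bar> - L * \<bar>w\<bar>"] zero_le_power2[of "\<bar>g 0\<bar> - L * \<bar>y\<bar>"]
      zero_le_power2[of "L * \<bar>w\<bar> - L * \<bar>y\<bar>"]
    unfolding power2_eq_square by (simp add: algebra_simps)
  finally show ?thesis by (simp add: power_mult_distrib algebra_simps)
qed

end

section \<open>Truncation and independence\<close>

lemma clamp_lipschitz:
  fixes g :: "real \<Rightarrow> real"
  assumes "L-lipschitz_on UNIV g"
  shows "L-lipschitz_on UNIV (\<lambda>x. max (- K) (min K (g x)))"
proof (rule lipschitz_onI)
  show "0 \<le> L" by (rule lipschitz_on_nonneg[OF assms])
  fix x y
  have "dist (max (- K) (min K (g x))) (max (- K) (min K (g y))) \<le> dist (g x) (g y)"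
    by (auto simp: dist_real_def max_def min_def)
  with lipschitz_onD[OF assms, of x y]
  show "dist (max (- K) (min K (g x))) (max (- K) (min K (g y))) \<le> L * dist x y" by simp
qed

text \<open>Clamping changes \<open>a\<close> only when its absolute value exceeds \<open>K\<close>,
  and then that absolute value is itself at most \<open>a\<^sup>2 / K\<close>.\<close>

lemma clamp_error:
  fixes a K :: real
  assumes K: "0 < K"
  shows "\<bar>a - max (- K) (min K a)\<bar> \<le> a\<^sup>2 / K"
proof (cases "\<bar>a\<bar> \<le> K")
  case True then show ?thesis using K by (auto simp: max_def min_def)
next
  case False
  then have "\<bar>a - max (- K) (min K a)\<bar> \<le> \<bar>a\<bar>" using K by (auto simp: max_def min_def)
  have "\<bar>a\<bar> * K \<le> a\<^sup>2"
    using False mult_left_mono[of K "\<bar>a\<bar>" "\<bar>a\<bar>"] by (simp add: power2_eq_square)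
  then have "\<bar>a\<bar> \<le> a\<^sup>2 / K" using K by (simp add: field_simps)
  with \<open>\<bar>a - max (- K) (min K a)\<bar> \<le> \<bar>a\<bar>\<close> show ?thesis by (rule order_trans)
qed

context sublinear_expectation_space
begin

lemma E_lipschitz:
  assumes g: "L-lipschitz_on UNIV g" and Y: "Y \<in> borel_measurable M" "(\<lambda>\<omega>. (Y \<omega>)\<^sup>2) \<in> L1"
  shows "L-lipschitz_on UNIV (\<lambda>w. E (\<lambda>\<omega>. g (w + Y \<omega>)))"
proof (rule lipschitz_onI)
  show "0 \<le> L" by (rule lipschitz_on_nonneg[OF g])
  fix x y
  have L1: "(\<lambda>\<omega>. g (w + Y \<omega>)) \<in> L1" for w
    by (rule lipschitz_L1(2)[OF g]) (use Y in \<open>auto intro!: L2_add intro: L1_const\<close>)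
  have "\<bar>E (\<lambda>\<omega>. g (x + Y \<omega>)) - E (\<lambda>\<omega>. g (y + Y \<omega>))\<bar> \<le> E (\<lambda>\<omega>. L * dist x y)"
  proof (rule E_dist[OF L1 L1 L1_const])
    show "\<bar>g (x + Y \<omega>) - g (y + Y \<omega>)\<bar> \<le> L * dist x y" for \<omega>
      using lipschitz_onD[OF g, of "x + Y \<omega>" "y + Y \<omega>"] by (simp add: dist_real_def)
  qed
  then show "dist (E (\<lambda>\<omega>. g (x + Y \<omega>))) (E (\<lambda>\<omega>. g (y + Y \<omega>))) \<le> L * dist x y"
    by (simp add: E_const dist_real_def)
qed

lemma indep_of_sum:
  assumes ind: "indep_of P \<Theta> 1 (segment_vec X (i + 1) 1) i (segment_vec X 1 i)"
    and X: "\<And>j. j \<in> {1..i+1} \<Longrightarrow> X j \<in> borel_measurable M"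
    and X2: "\<And>j. j \<in> {1..i+1} \<Longrightarrow> (\<lambda>\<omega>. (X j \<omega> - \<mu>)\<^sup>2) \<in> L1"
    and S2: "(\<lambda>\<omega>. (\<Sum>j=1..i. X j \<omega> - \<mu>)\<^sup>2) \<in> L1"
    and g: "L-lipschitz_on UNIV g" and gb: "\<And>x. \<bar>g x\<bar> \<le> K"
  shows "E (\<lambda>\<omega>. g ((\<Sum>j=1..i. X j \<omega> - \<mu>) + (X (i + 1) \<omega> - \<mu>))) =
    E (\<lambda>\<omega>. E (\<lambda>\<omega>'. g ((\<Sum>j=1..i. X j \<omega> - \<mu>) + (X (i + 1) \<omega>' - \<mu>))))"
proof -
  define S where "S = (\<lambda>\<omega>. \<Sum>j=1..i. X j \<omega> - \<mu>)"
  define Y where "Y = (\<lambda>\<omega>. X (i + 1) \<omega> - \<mu>)"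
  \<comment> \<open>Coordinates of \<open>segment_vec\<close> are zero-based, so coordinate
    \<open>j\<close> carries \<open>X (j + 1)\<close>; coordinate \<open>i\<close> is the new
    variable.\<close>
  define \<phi> where "\<phi> = (\<lambda>x::nat \<Rightarrow> real. g (\<Sum>j<i + 1. x j - \<mu>))"
  have Sm: "S \<in> borel_measurable M" unfolding S_def using X by (auto intro!: borel_measurable_sum)
  have Ym: "Y \<in> borel_measurable M" unfolding Y_def using X by auto
  have Y2: "(\<lambda>\<omega>. (Y \<omega>)\<^sup>2) \<in> L1" unfolding Y_def using X2 by auto
  have S2: "(\<lambda>\<omega>. (S \<omega>)\<^sup>2) \<in> L1" unfolding S_def using S2 .
  \<comment> \<open>Two sample points, because the left side of the independence relation needs
    \<omega>' = \<omega> while the inner expectation on the right has the past frozen at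
    \<omega>.\<close>
  have app: "\<phi> (vec_append i (segment_vec X 1 i \<omega>) (segment_vec X (i + 1) 1 \<omega>')) = g (S \<omega> + Y \<omega>')"
    for \<omega> \<omega>'
  proof -
    have "(\<Sum>j<i + 1. vec_append i (segment_vec X 1 i \<omega>) (segment_vec X (i + 1) 1 \<omega>') j - \<mu>)
       = (\<Sum>j<i. X (Suc j) \<omega> - \<mu>) + (X (i + 1) \<omega>' - \<mu>)"
      by (simp add: vec_append_def segment_vec_def)
    also have "(\<Sum>j<i. X (Suc j) \<omega> - \<mu>) = S \<omega>"
      unfolding S_def by (rule sum.reindex_bij_witness[of _ "\<lambda>j. j - 1" Suc]) auto
    finally show ?thesis unfolding \<phi>_def Y_def by (rule arg_cong)
  qed
  have gc: "continuous_map euclideanreal euclideanreal g"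
    using lipschitz_on_continuous_on[OF g] by simp
  have "continuous_map (Euclidean_space (i + 1)) euclideanreal (\<lambda>x. \<Sum>j<i + 1. x j - \<mu>)"
    by (intro continuous_map_sum continuous_map_diff continuous_map_const[THEN iffD2])
      (auto simp: Euclidean_space_def intro!: continuous_map_from_subtopology
         continuous_map_product_coordinates)
  from continuous_map_compose[OF this gc]
  have c: "continuous_map (Euclidean_space (i + 1)) euclideanreal \<phi>"
    by (simp add: \<phi>_def o_def)
  have b: "bounded (\<phi> ` topspace (Euclidean_space (i + 1)))"
    by (rule boundedI[of _ K]) (auto simp: \<phi>_def gb)
  have gL1: "(\<lambda>\<omega>. g (w + Y \<omega>)) \<in> L1" for w
    by (rule lipschitz_L1(2)[OF g]) (use Ym Y2 in \<open>auto intro!: L2_add intro: L1_const\<close>)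
  have 1: "(\<lambda>\<omega>. g (S \<omega> + Y \<omega>)) \<in> L1"
    by (rule lipschitz_L1(2)[OF g]) (use Sm S2 Ym Y2 in \<open>auto intro!: L2_add\<close>)
  have 2: "(\<lambda>\<omega>. E (\<lambda>\<omega>'. g (S \<omega> + Y \<omega>'))) \<in> L1"
    by (rule lipschitz_L1(2)[OF E_lipschitz[OF g Ym Y2] Sm S2])
  have "sublin_expectation P \<Theta> (\<lambda>\<omega>. g (S \<omega> + Y \<omega>)) =
      sublin_expectation P \<Theta> (\<lambda>\<omega>. real_of_ereal (sublin_expectation P \<Theta> (\<lambda>\<omega>'. g (S \<omega> + Y \<omega>'))))"
    using ind[unfolded indep_of_def, rule_format, OF conjI, OF c b] unfolding app .
  then have "E (\<lambda>\<omega>. g (S \<omega> + Y \<omega>)) = E (\<lambda>\<omega>. E (\<lambda>\<omega>'. g (S \<omega> + Y \<omega>')))"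
    using 1 2 gL1 by (simp add: sublin_expectation_L1)
  then show ?thesis unfolding S_def Y_def .
qed

text \<open>
  Independence only speaks about bounded test functions; a Lipschitz one is clamped to \<open>[-K, K]\<close>,
  with error at most \<open>g\<^sup>2 / K\<close>, and \<open>K\<close> tends to infinity.
\<close>

lemma indep_of_sum_error:
  assumes ind: "indep_of P \<Theta> 1 (segment_vec X (i + 1) 1) i (segment_vec X 1 i)"
    and X: "\<And>j. j \<in> {1..i+1} \<Longrightarrow> X j \<in> borel_measurable M"
    and X2: "\<And>j. j \<in> {1..i+1} \<Longrightarrow> (\<lambda>\<omega>. (X j \<omega> - \<mu>)\<^sup>2) \<in> L1"
    and S2: "(\<lambda>\<omega>. (\<Sum>j=1..i. X j \<omega> - \<mu>)\<^sup>2) \<in> L1"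
    and g: "L-lipschitz_on UNIV g" and h: "L'-lipschitz_on UNIV h"
    and le: "\<And>w. \<bar>E (\<lambda>\<omega>. g (w + (X (i + 1) \<omega> - \<mu>))) - h w\<bar> \<le> \<delta>"
  shows "\<bar>E (\<lambda>\<omega>. g ((\<Sum>j=1..i. X j \<omega> - \<mu>) + (X (i + 1) \<omega> - \<mu>))) -
    E (\<lambda>\<omega>. h (\<Sum>j=1..i. X j \<omega> - \<mu>))\<bar> \<le> \<delta>"
proof -
  define S where "S = (\<lambda>\<omega>. \<Sum>j=1..i. X j \<omega> - \<mu>)"
  define Y where "Y = (\<lambda>\<omega>. X (i + 1) \<omega> - \<mu>)"
  have Sm: "S \<in> borel_measurable M" unfolding S_def using X by (auto intro!: borel_measurable_sum)
  have Ym: "Y \<in> borel_measurable M" unfolding Y_def using X by auto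
  have Y2: "(\<lambda>\<omega>. (Y \<omega>)\<^sup>2) \<in> L1" unfolding Y_def using X2 by auto
  have S2': "(\<lambda>\<omega>. (S \<omega>)\<^sup>2) \<in> L1" unfolding S_def using S2 .
  have SY2: "(\<lambda>\<omega>. (S \<omega> + Y \<omega>)\<^sup>2) \<in> L1" by (rule L2_add[OF Sm S2' Ym Y2])
  have SYm: "(\<lambda>\<omega>. S \<omega> + Y \<omega>) \<in> borel_measurable M" using Sm Ym by simp
  have wY: "(\<lambda>\<omega>. w + Y \<omega>) \<in> borel_measurable M" "(\<lambda>\<omega>. (w + Y \<omega>)\<^sup>2) \<in> L1" for w
    using Ym Y2 by (auto intro!: L2_add intro: L1_const)
  define A where "A = E (\<lambda>\<omega>. g (S \<omega> + Y \<omega>))"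
  define B where "B = E (\<lambda>\<omega>. h (S \<omega>))"
  define C where "C = E (\<lambda>\<omega>. (g (S \<omega> + Y \<omega>))\<^sup>2)"
  \<comment> \<open>Bounds the second moment of \<open>g (w + Y)\<close> for frozen
    \<open>w\<close>. It may grow with \<open>w\<close>, since only its expectation \<open>D\<close>
    along \<open>S\<close> matters.\<close>
  define q where "q = (\<lambda>w. 3 * (g 0)\<^sup>2 + 3 * L\<^sup>2 * w\<^sup>2 + 3 * L\<^sup>2 * E (\<lambda>\<omega>. (Y \<omega>)\<^sup>2))"
  define D where "D = E (\<lambda>\<omega>. q (S \<omega>))"
  have qL1: "(\<lambda>\<omega>. q (S \<omega>)) \<in> L1" unfolding q_def by (intro L1_intros S2')
  \<comment> \<open>\<open>C\<close> and \<open>D\<close> do not depend on \<open>K\<close>. The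
    error consists of clamping along \<open>S + Y\<close> (\<open>C / K\<close>), nothing for the
    exact identity of the clamped function, the assumed \<delta>, and clamping with \<open>w\<close>
    frozen (\<open>D / K\<close>).\<close>
  have bound: "\<bar>A - B\<bar> \<le> \<delta> + (C + D) / K" if K: "0 < K" for K
  proof -
    define gK where "gK = (\<lambda>x. max (- K) (min K (g x)))"
    have gK: "L-lipschitz_on UNIV gK" unfolding gK_def by (rule clamp_lipschitz[OF g])
    have gKb: "\<bar>gK x\<bar> \<le> K" for x using K by (auto simp: gK_def max_def min_def)
    define hK where "hK = (\<lambda>w. E (\<lambda>\<omega>. gK (w + Y \<omega>)))"
    have hK: "L-lipschitz_on UNIV hK" unfolding hK_def by (rule E_lipschitz[OF gK Ym Y2])
    have err: "\<bar>g x - gK x\<bar> \<le> inverse K * (g x)\<^sup>2" for x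
      using clamp_error[OF K, of "g x"] by (simp add: gK_def field_simps)
    have 1: "\<bar>A - E (\<lambda>\<omega>. gK (S \<omega> + Y \<omega>))\<bar> \<le> C / K"
    proof -
      have "\<bar>A - E (\<lambda>\<omega>. gK (S \<omega> + Y \<omega>))\<bar> \<le> E (\<lambda>\<omega>. inverse K * (g (S \<omega> + Y \<omega>))\<^sup>2)"
        unfolding A_def
        by (rule E_dist[OF lipschitz_L1(2)[OF g SYm SY2] lipschitz_L1(2)[OF gK SYm SY2]
              L1_cmult[OF lipschitz_L1(1)[OF g SYm SY2]] err])
      also have "\<dots> = C / K" unfolding C_def
        using K by (subst E_cmult[OF lipschitz_L1(1)[OF g SYm SY2]]) (auto simp: field_simps)
      finally show ?thesis .
    qed
    have 2: "E (\<lambda>\<omega>. gK (S \<omega> + Y \<omega>)) = E (\<lambda>\<omega>. hK (S \<omega>))"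
      unfolding hK_def S_def Y_def by (rule indep_of_sum[OF ind X X2 S2 gK gKb])
    have 3: "\<bar>hK w - h w\<bar> \<le> \<delta> + inverse K * q w" for w
    proof -
      have "\<bar>E (\<lambda>\<omega>. g (w + Y \<omega>)) - hK w\<bar> \<le> E (\<lambda>\<omega>. inverse K * (g (w + Y \<omega>))\<^sup>2)"
        unfolding hK_def
        by (rule E_dist[OF lipschitz_L1(2)[OF g wY] lipschitz_L1(2)[OF gK wY]
              L1_cmult[OF lipschitz_L1(1)[OF g wY]] err])
      also have "\<dots> = inverse K * E (\<lambda>\<omega>. (g (w + Y \<omega>))\<^sup>2)"
        using K by (subst E_cmult[OF lipschitz_L1(1)[OF g wY]]) auto
      also have "\<dots> \<le> inverse K * q w"
      proof (rule mult_left_mono)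
        have "E (\<lambda>\<omega>. (g (w + Y \<omega>))\<^sup>2) \<le> E (\<lambda>\<omega>. (3 * (g 0)\<^sup>2 + 3 * L\<^sup>2 * w\<^sup>2) + 3 * L\<^sup>2 * (Y \<omega>)\<^sup>2)"
          by (rule E_mono[OF lipschitz_L1(1)[OF g wY]])
            (auto intro!: L1_intros Y2 lipschitz_shift_sq[OF g])
        also have "\<dots> \<le> E (\<lambda>\<omega>. (3 * (g 0)\<^sup>2 + 3 * L\<^sup>2 * w\<^sup>2)) + E (\<lambda>\<omega>. 3 * L\<^sup>2 * (Y \<omega>)\<^sup>2)"
          by (intro E_add_le L1_intros Y2)
        also have "\<dots> = q w" unfolding q_def by (subst E_cmult[OF Y2]) (auto simp: E_const)
        finally show "E (\<lambda>\<omega>. (g (w + Y \<omega>))\<^sup>2) \<le> q w" .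
      qed (use K in auto)
      finally show ?thesis using le[of w, folded Y_def[THEN fun_cong]] by linarith
    qed
    have "\<bar>E (\<lambda>\<omega>. hK (S \<omega>)) - B\<bar> \<le> E (\<lambda>\<omega>. \<delta> + inverse K * q (S \<omega>))"
      unfolding B_def
      by (rule E_dist[OF lipschitz_L1(2)[OF hK Sm S2'] lipschitz_L1(2)[OF h Sm S2'] _ 3])
        (intro L1_intros qL1)
    also have "\<dots> \<le> \<delta> + E (\<lambda>\<omega>. inverse K * q (S \<omega>))"
      using E_add_le[OF L1_const[of \<delta>] L1_cmult[OF qL1, of "inverse K"]] by (simp add: E_const)
    also have "\<dots> = \<delta> + D / K" unfolding D_def
      using K by (subst E_cmult[OF qL1]) (auto simp: field_simps)
    finally show ?thesis using 1 2 by (simp add: add_divide_distrib)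
  qed
  have "((\<lambda>K. \<delta> + (C + D) / K) \<longlongrightarrow> \<delta> + 0) at_top"
    by (intro tendsto_intros tendsto_divide_0[OF tendsto_const] filterlim_at_top_imp_at_infinity filterlim_ident)
  then have "\<bar>A - B\<bar> \<le> \<delta> + 0"
    by (rule tendsto_lowerbound) (auto intro!: eventually_mono[OF eventually_gt_at_top[of 0]] bound)
  then show ?thesis unfolding A_def B_def S_def Y_def by simp
qed

end

subsection \<open>Gaussian smoothing\<close>

lemma taylor2_upper:
  fixes f f' f'' :: "real \<Rightarrow> real"
  assumes f: "\<And>x. (f has_real_derivative f' x) (at x)"
    and f': "\<And>x. (f' has_real_derivative f'' x) (at x)"
    and f'': "\<And>x y. \<bar>f'' x - f'' y\<bar> \<le> K * \<bar>x - y\<bar>" and y: "0 \<le> y"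
  shows "f (x + y) - f x - f' x * y - f'' x * y\<^sup>2 / 2 \<le> K * y ^ 3 / 6"
proof -
  \<comment> \<open>\<open>g\<close> is the slack of the claim as a function of the increment. It
    vanishes at 0 together with \<open>g'\<close>, and the Lipschitz bound says \<open>g''\<close>
    is nonnegative on the half-line, so two monotonicity arguments suffice and no third derivative
    is needed.\<close>
  define g where "g = (\<lambda>y. K * y ^ 3 / 6 + f x + f' x * y + f'' x * y\<^sup>2 / 2 - f (x + y))"
  define g' where "g' = (\<lambda>y. K * y\<^sup>2 / 2 + f' x + f'' x * y - f' (x + y))"
  define g'' where "g'' = (\<lambda>y. K * y + f'' x - f'' (x + y))"
  have plus: "((+) x has_real_derivative 1) (at y)" for y by (auto intro!: derivative_eq_intros)
  note shift = DERIV_chain2[OF f plus] DERIV_chain2[OF f' plus]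
  have g: "(g has_real_derivative g' y) (at y)" for y
    unfolding g_def g'_def
    by (auto intro!: shift derivative_eq_intros simp: power2_eq_square)
  have g': "(g' has_real_derivative g'' y) (at y)" for y
    unfolding g'_def g''_def
    by (auto intro!: shift derivative_eq_intros simp: power2_eq_square)
  have g'': "0 \<le> g'' y" if "0 \<le> y" for y
    using f''[of "x + y" x] that unfolding g''_def by simp
  have "g' 0 \<le> g' y" if "0 \<le> y" for y
    by (rule DERIV_nonneg_imp_nondecreasing[OF that]) (use g' g'' in blast)
  then have g'0: "0 \<le> g' y" if "0 \<le> y" for y using that by (simp add: g'_def)
  have "g 0 \<le> g y"
    by (rule DERIV_nonneg_imp_nondecreasing[OF y]) (use g g'0 in blast)
  then show ?thesis by (simp add: g_def)
qed

lemma taylor2: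
  fixes f f' f'' :: "real \<Rightarrow> real"
  assumes f: "\<And>x. (f has_real_derivative f' x) (at x)"
    and f': "\<And>x. (f' has_real_derivative f'' x) (at x)"
    and f'': "\<And>x y. \<bar>f'' x - f'' y\<bar> \<le> K * \<bar>x - y\<bar>"
  shows "\<bar>f (x + y) - f x - f' x * y - f'' x * y\<^sup>2 / 2\<bar> \<le> K * \<bar>y\<bar> ^ 3 / 6"
proof -
  \<comment> \<open>Kept general in \<open>h\<close> because it serves both \<open>f\<close> and its
    reflection.\<close>
  have nonneg: "\<bar>h (x + y) - h x - h' x * y - h'' x * y\<^sup>2 / 2\<bar> \<le> K * y ^ 3 / 6"
    if h: "\<And>x. (h has_real_derivative h' x) (at x)"
      and h': "\<And>x. (h' has_real_derivative h'' x) (at x)"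
      and h'': "\<And>x y. \<bar>h'' x - h'' y\<bar> \<le> K * \<bar>x - y\<bar>" and y: "0 \<le> y"
    for h h' h'' :: "real \<Rightarrow> real" and x y
  proof -
    have "h (x + y) - h x - h' x * y - h'' x * y\<^sup>2 / 2 \<le> K * y ^ 3 / 6"
      by (rule taylor2_upper[OF h h' h'' y])
    moreover have "- h (x + y) - - h x - - h' x * y - - h'' x * y\<^sup>2 / 2 \<le> K * y ^ 3 / 6"
    proof (rule taylor2_upper[of "\<lambda>x. - h x" "\<lambda>x. - h' x" "\<lambda>x. - h'' x", OF _ _ _ y])
      show "\<bar>- h'' x - - h'' y\<bar> \<le> K * \<bar>x - y\<bar>" for x y using h''[of x y] by simp
    qed (auto intro!: derivative_eq_intros h h')
    ultimately show ?thesis by linarith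
  qed
  show ?thesis
  proof (cases "0 \<le> y")
    case True
    then show ?thesis using nonneg[OF f f' f'' True, of x] by simp
  next
    case False
    \<comment> \<open>Reflection at the origin makes the increment positive; it flips the sign of
      the first derivative and preserves that of the second.\<close>
    have "\<bar>f (- (- x + - y)) - f (- (- x)) - - f' (- (- x)) * - y - f'' (- (- x)) * (- y)\<^sup>2 / 2\<bar>
        \<le> K * (- y) ^ 3 / 6"
    proof (rule nonneg[of "\<lambda>x. f (- x)" "\<lambda>x. - f' (- x)" "\<lambda>x. f'' (- x)"])
      show "\<bar>f'' (- x) - f'' (- y)\<bar> \<le> K * \<bar>x - y\<bar>" for x y
        using f''[of "-x" "-y"] by (simp add: abs_minus_commute)
    next
      fix x
      have m: "(uminus has_real_derivative - 1) (at x)" by (auto intro!: derivative_eq_intros)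
      show "((\<lambda>x. f (- x)) has_real_derivative - f' (- x)) (at x)"
        using DERIV_chain2[OF f m] by simp
      show "((\<lambda>x. - f' (- x)) has_real_derivative f'' (- x)) (at x)"
        using DERIV_minus[OF DERIV_chain2[OF f' m]] by simp
    qed (use False in simp)
    then show ?thesis using False by (simp add: add.commute)
  qed
qed

text \<open>
  Only the second-order expansion with a Lipschitz second derivative is available, so the sign is
  read off from the symmetric second difference for small \<open>h\<close>.
\<close>

lemma convex_imp_second_derivative_nonneg:
  fixes f f' f'' :: "real \<Rightarrow> real"
  assumes f: "\<And>x. (f has_real_derivative f' x) (at x)"
    and f': "\<And>x. (f' has_real_derivative f'' x) (at x)"
    and f'': "\<And>x y. \<bar>f'' x - f'' y\<bar> \<le> K * \<bar>x - y\<bar>"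
    and conv: "convex_on UNIV f"
  shows "0 \<le> f'' x"
proof (rule field_le_epsilon)
  fix e :: real assume e: "0 < e"
  have K: "0 \<le> K" using f''[of 1 0] by simp
  \<comment> \<open>Small enough that the remainder \<open>K * h / 3\<close> is at most
    \<open>e\<close>; the \<open>+ 1\<close> covers \<open>K = 0\<close>.\<close>
  define h where "h = e / (K + 1)"
  have h: "0 < h" using e K by (simp add: h_def)
  have "f x \<le> (f (x + h) + f (x - h)) / 2"
    using convex_onD[OF conv, of "1/2" "x + h" "x - h"] by (simp add: field_simps)
  moreover have "f (x + h) - f x - f' x * h - f'' x * h\<^sup>2 / 2 \<le> K * h ^ 3 / 6"
    using abs_le_D1[OF taylor2[OF f f' f'', of x h]] h by simp
  moreover have "f (x - h) - f x + f' x * h - f'' x * h\<^sup>2 / 2 \<le> K * h ^ 3 / 6"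
    using abs_le_D1[OF taylor2[OF f f' f'', of x "- h"]] h by simp
  ultimately have "0 \<le> f'' x * h\<^sup>2 + K * h ^ 3 / 3" by (simp add: field_simps)
  also have "\<dots> = h\<^sup>2 * (f'' x + K * h / 3)"
    by (simp add: power2_eq_square power3_eq_cube algebra_simps)
  finally have "0 \<le> f'' x + K * h / 3" using h by (simp add: zero_le_mult_iff)
  moreover have "K * h / 3 \<le> e"
    using e K by (simp add: h_def field_simps)
  ultimately show "0 \<le> f'' x + e" by linarith
qed

section \<open>Gaussian moments and differentiation under the integral\<close>

abbreviation (input) gauss :: "real \<Rightarrow> real" where
  "gauss \<equiv> std_normal_density"

lemma gauss_DERIV: "(gauss has_real_derivative - (x * gauss x)) (at x)"
proof -
  have "((\<lambda>x. c * exp (- x\<^sup>2 / 2)) has_real_derivative - (x * (c * exp (- x\<^sup>2 / 2)))) (at x)" for c :: real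
    by (auto intro!: derivative_eq_intros)
  then show ?thesis unfolding std_normal_density_def .
qed

text \<open>The exact first and third absolute moments are \<open>sqrt (2 / pi)\<close> and
  \<open>2 * sqrt (2 / pi)\<close>; rounding them up to 1 and 2 costs nothing in the final
  constants.\<close>

lemma gauss_moments:
  "(\<integral>z. gauss z \<partial>lborel) = 1" "(\<integral>z. gauss z * z \<partial>lborel) = 0" "(\<integral>z. gauss z * z\<^sup>2 \<partial>lborel) = 1"
  "(\<integral>z. gauss z * \<bar>z\<bar> \<partial>lborel) \<le> 1" "(\<integral>z. gauss z * \<bar>z\<bar> ^ 3 \<partial>lborel) \<le> 2"
proof -
  have le: "sqrt (2 / pi) \<le> 1" using pi_gt3 by (simp add: real_sqrt_le_1_iff)
  show "(\<integral>z. gauss z \<partial>lborel) = 1" by simp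
  show "(\<integral>z. gauss z * z \<partial>lborel) = 0" using integral_std_normal_moment_odd[of 0] by simp
  show "(\<integral>z. gauss z * z\<^sup>2 \<partial>lborel) = 1" using integral_std_normal_moment_even[of 1] by simp
  show "(\<integral>z. gauss z * \<bar>z\<bar> \<partial>lborel) \<le> 1"
    using integral_std_normal_moment_abs_odd[of 0] le by simp
  show "(\<integral>z. gauss z * \<bar>z\<bar> ^ 3 \<partial>lborel) \<le> 2"
    using integral_std_normal_moment_abs_odd[of 1] le by (simp add: numeral_3_eq_3)
qed

lemma gauss_moment_integrable:
  "integrable lborel (\<lambda>z. gauss z * z)" "integrable lborel (\<lambda>z. gauss z * z\<^sup>2)"
  "integrable lborel (\<lambda>z. gauss z * \<bar>z\<bar>)" "integrable lborel (\<lambda>z. gauss z * \<bar>z\<bar> ^ 3)"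
  using integrable_std_normal_moment[of 1] integrable_std_normal_moment[of 2]
    integrable_std_normal_moment_abs[of 1] integrable_std_normal_moment_abs[of 3] by simp_all

text \<open>A majorant at \<open>z\<close> for kernel values anywhere within distance 1, as needed
  for difference quotients. Half of the exponent absorbs the polynomial factor, and moving from
  \<open>w\<close> to \<open>z\<close> halves the rest, which leaves variance 4. The constant is 4
  from the polynomial, 2 for \<open>exp (1 / 4)\<close>, and the normalisation
  \<open>sqrt (8 * pi)\<close> of that density.\<close>

lemma gauss_kernel_tail:
  fixes w z :: real
  assumes "\<bar>w - z\<bar> \<le> 1"
  shows "(1 + w\<^sup>2) * gauss w \<le> 8 * sqrt (8 * pi) * normal_density 0 2 z"
proof -
  have "1 + w\<^sup>2 \<le> 4 * (1 + w\<^sup>2 / 4)" by simp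
  also have "\<dots> \<le> 4 * exp (w\<^sup>2 / 4)" by (intro mult_left_mono exp_ge_add_one_self) simp
  finally have 1: "1 + w\<^sup>2 \<le> 4 * exp (w\<^sup>2 / 4)" .
  have "1 \<le> sqrt (2 * pi)" using pi_gt3 by simp
  then have 2: "gauss w \<le> exp (- w\<^sup>2 / 2)"
    unfolding std_normal_density_def by (simp add: field_simps)
  have "z\<^sup>2 \<le> 2 * w\<^sup>2 + 2 * (w - z)\<^sup>2"
    using zero_le_power2[of "2 * w - z"] by (simp add: power2_eq_square algebra_simps)
  moreover have "(w - z)\<^sup>2 \<le> 1" using assms by (simp add: abs_square_le_1)
  ultimately have "z\<^sup>2 \<le> 2 * w\<^sup>2 + 2" by simp
  then have 3: "- (w\<^sup>2 / 4) \<le> 1 / 4 + - z\<^sup>2 / 8" by simp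
  have e: "exp (1 / 4 :: real) \<le> 2"
    using exp_bound[of "1/4"] by (simp add: power2_eq_square)
  have "(1 + w\<^sup>2) * gauss w \<le> (4 * exp (w\<^sup>2 / 4)) * exp (- w\<^sup>2 / 2)"
    by (intro mult_mono 1 2) auto
  also have "\<dots> = 4 * exp (- (w\<^sup>2 / 4))" by (simp add: exp_add[symmetric])
  also have "\<dots> \<le> 4 * exp (1 / 4 + - z\<^sup>2 / 8)" using 3 by simp
  also have "\<dots> \<le> 8 * exp (- z\<^sup>2 / 8)" 
    unfolding exp_add using mult_right_mono[OF e, of "exp (- z\<^sup>2 / 8)"] by simp
  also have "\<dots> = 8 * sqrt (8 * pi) * normal_density 0 2 z"
    by (simp add: normal_density_def)
  finally show ?thesis .
qed

lemma linear_growth_integrable: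
  fixes \<psi> :: "real \<Rightarrow> real"
  assumes m: "k \<in> borel_measurable borel" "\<psi> \<in> borel_measurable borel"
    and \<psi>: "\<And>z. \<bar>\<psi> z\<bar> \<le> A + B * \<bar>z\<bar>"
    and k: "\<And>z. \<bar>k z\<bar> \<le> (1 + z\<^sup>2) * gauss z"
  shows "integrable lborel (\<lambda>z. k z * \<psi> z)"
proof (rule Bochner_Integration.integrable_bound)
  show "integrable lborel (\<lambda>z. 8 * sqrt (8 * pi) * (A * normal_density 0 2 z + B * (normal_density 0 2 z * \<bar>z\<bar>)))"
    using integrable_normal_moment_abs[of 2 0 1]
    by (intro integrable_mult_right Bochner_Integration.integrable_add integrable_normal_density) simp_all
  show "(\<lambda>z. k z * \<psi> z) \<in> borel_measurable lborel" using m by simp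
  show "AE z in lborel. norm (k z * \<psi> z) \<le> norm (8 * sqrt (8 * pi) * (A * normal_density 0 2 z + B * (normal_density 0 2 z * \<bar>z\<bar>)))"
  proof (rule AE_I2)
    fix z
    have "\<bar>k z\<bar> \<le> 8 * sqrt (8 * pi) * normal_density 0 2 z"
      using k[of z] gauss_kernel_tail[of z z] by simp
    then have "\<bar>k z\<bar> * \<bar>\<psi> z\<bar> \<le> (8 * sqrt (8 * pi) * normal_density 0 2 z) * (A + B * \<bar>z\<bar>)"
      by (intro mult_mono \<psi>) auto
    also have "\<dots> = 8 * sqrt (8 * pi) * (A * normal_density 0 2 z + B * (normal_density 0 2 z * \<bar>z\<bar>))"
      by (simp only: algebra_simps)
    finally show "norm (k z * \<psi> z) \<le> norm (8 * sqrt (8 * pi) * (A * normal_density 0 2 z + B * (normal_density 0 2 z * \<bar>z\<bar>)))"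
      unfolding real_norm_def abs_mult[of "k z"] by (rule order_trans[OF _ abs_ge_self])
  qed
qed

lemma linear_growth_shift:
  fixes \<psi> :: "real \<Rightarrow> real"
  assumes \<psi>: "\<And>z. \<bar>\<psi> z\<bar> \<le> A + B * \<bar>z\<bar>"
  shows "\<bar>\<psi> (z + t)\<bar> \<le> (A + \<bar>B\<bar> * \<bar>t\<bar>) + \<bar>B\<bar> * \<bar>z\<bar>"
proof -
  have "B * \<bar>z + t\<bar> \<le> \<bar>B\<bar> * (\<bar>z\<bar> + \<bar>t\<bar>)"
    by (rule mult_mono) auto
  then show ?thesis using \<psi>[of "z + t"] by (simp add: algebra_simps)
qed

text \<open>\<psi> need not be differentiable, so a substitution moves the translation onto the
  smooth kernel; hence the minus sign. The difference quotients of the kernel then converge under a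
  fixed integrable majorant.\<close>

lemma kernel_integral_DERIV_0:
  fixes k k' \<psi> :: "real \<Rightarrow> real"
  assumes k: "\<And>z. (k has_real_derivative k' z) (at z)"
    and k_bound: "\<And>z. \<bar>k z\<bar> \<le> (1 + z\<^sup>2) * gauss z"
    and k'_bound: "\<And>z. \<bar>k' z\<bar> \<le> (1 + z\<^sup>2) * gauss z"
    and k'm: "k' \<in> borel_measurable borel" and \<psi>m: "\<psi> \<in> borel_measurable borel"
    and \<psi>: "\<And>z. \<bar>\<psi> z\<bar> \<le> A + B * \<bar>z\<bar>"
  shows "((\<lambda>t. \<integral>z. k z * \<psi> (z + t) \<partial>lborel) has_real_derivative - (\<integral>z. k' z * \<psi> z \<partial>lborel)) (at 0)"
proof -
  have km: "k \<in> borel_measurable borel"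
    by (rule borel_measurable_continuous_onI) (auto intro!: DERIV_isCont k continuous_at_imp_continuous_on)
  have translate: "(\<integral>z. k z * \<psi> (z + t) \<partial>lborel) = (\<integral>z. k (z - t) * \<psi> z \<partial>lborel)" for t
    using lborel_integral_real_affine[of 1 "\<lambda>z. k z * \<psi> (z + t)" "- t"] by simp
  have shift_int: "integrable lborel (\<lambda>z. k (z - t) * \<psi> z)" for t
  proof -
    have "integrable lborel (\<lambda>z. k z * \<psi> (z + t))"
      by (rule linear_growth_integrable[OF km _ linear_growth_shift[OF \<psi>] k_bound])
        (use \<psi>m in simp)
    then show ?thesis
      using lborel_integrable_real_affine[of "\<lambda>z. k z * \<psi> (z + t)" 1 "- t"] by simp
  qed
  define q where "q = (\<lambda>h z. (k (z - h) - k z) / h * \<psi> z)"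
  define D where "D = (\<lambda>z. 8 * sqrt (8 * pi) * (A * normal_density 0 2 z + B * (normal_density 0 2 z * \<bar>z\<bar>)))"
  have Dint: "integrable lborel D" unfolding D_def
    using integrable_normal_moment_abs[of 2 0 1]
    by (intro integrable_mult_right Bochner_Integration.integrable_add integrable_normal_density) simp_all
  \<comment> \<open>By the mean value inequality the quotient is at most the supremum of the
    derivative within distance 1 of \<open>z\<close>, which \<open>gauss_kernel_tail\<close> bounds
    uniformly in \<open>h\<close>.\<close>
  have q_bound: "\<bar>q h z\<bar> \<le> D z" if h: "\<bar>h\<bar> \<le> 1" "h \<noteq> 0" for h z
  proof -
    have "norm (k (z - h) - k z) \<le> (8 * sqrt (8 * pi) * normal_density 0 2 z) * norm (z - h - z)"
    proof (rule field_differentiable_bound[of "{z - 1..z + 1}" k k'])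
      fix w assume w: "w \<in> {z - 1..z + 1}"
      show "(k has_field_derivative k' w) (at w within {z - 1..z + 1})"
        by (rule has_field_derivative_at_within[OF k])
      show "norm (k' w) \<le> 8 * sqrt (8 * pi) * normal_density 0 2 z"
        using k'_bound[of w] gauss_kernel_tail[of w z] w by (simp add: abs_le_iff)
    qed (use h in auto)
    then have "\<bar>(k (z - h) - k z) / h\<bar> \<le> 8 * sqrt (8 * pi) * normal_density 0 2 z"
      using h by (simp add: field_simps)
    then have "\<bar>(k (z - h) - k z) / h\<bar> * \<bar>\<psi> z\<bar> \<le> (8 * sqrt (8 * pi) * normal_density 0 2 z) * (A + B * \<bar>z\<bar>)"
      by (intro mult_mono \<psi>) auto
    also have "\<dots> = D z" by (simp only: D_def algebra_simps)
    finally show ?thesis unfolding q_def by (simp only: abs_mult)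
  qed
  have q_lim: "((\<lambda>h. q h z) \<longlongrightarrow> - k' z * \<psi> z) (at 0)" for z
  proof -
    have "((\<lambda>h. k (z - h)) has_real_derivative - k' z) (at 0)"
      by (rule DERIV_chain2[of k "k' z" "\<lambda>h. z - h", THEN DERIV_cong])
        (auto intro!: derivative_eq_intros k)
    then have "((\<lambda>h. (k (z - h) - k z) / h) \<longlongrightarrow> - k' z) (at 0)"
      unfolding DERIV_def by simp
    then show ?thesis unfolding q_def by (intro tendsto_intros)
  qed
  \<comment> \<open>The limit is first taken within [-1, 1], so that the majorant holds for every
    member of a sequence; 0 is an interior point, so the restriction then drops out.\<close>
  have int_lim: "((\<lambda>h. \<integral>z. q h z \<partial>lborel) \<longlongrightarrow> (\<integral>z. - k' z * \<psi> z \<partial>lborel)) (at 0 within {-1..1})"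
    unfolding tendsto_at_iff_sequentially o_def
  proof (intro allI impI)
    fix H :: "nat \<Rightarrow> real" assume H: "\<forall>i. H i \<in> {-1..1} - {0}" and H0: "H \<longlonglongrightarrow> 0"
    have Hat: "filterlim H (at 0) sequentially"
      using H H0 by (auto simp: filterlim_at)
    show "(\<lambda>i. \<integral>z. q (H i) z \<partial>lborel) \<longlonglongrightarrow> (\<integral>z. - k' z * \<psi> z \<partial>lborel)"
    proof (rule integral_dominated_convergence[OF _ _ Dint])
      show "AE z in lborel. (\<lambda>i. q (H i) z) \<longlonglongrightarrow> - k' z * \<psi> z"
        by (intro AE_I2 filterlim_compose[OF q_lim Hat])
      show "AE z in lborel. norm (q (H i) z) \<le> D z" for i
        using H[rule_format, of i] by (intro AE_I2) (auto intro!: q_bound)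
    qed (use km k'm \<psi>m in \<open>auto simp: q_def\<close>)
  qed
  have "((\<lambda>h. \<integral>z. q h z \<partial>lborel) \<longlongrightarrow> - (\<integral>z. k' z * \<psi> z \<partial>lborel)) (at 0)"
    using int_lim at_within_Icc_at[of "-1" 0 "1::real"] by simp
  moreover have "(\<integral>z. q h z \<partial>lborel) = ((\<integral>z. k z * \<psi> (z + h) \<partial>lborel) - (\<integral>z. k z * \<psi> (z + 0) \<partial>lborel)) / h" for h
  proof -
    have "(\<integral>z. q h z \<partial>lborel) = (\<integral>z. (k (z - h) * \<psi> z - k (z - 0) * \<psi> z) / h \<partial>lborel)"
      by (intro Bochner_Integration.integral_cong) (auto simp: q_def algebra_simps diff_divide_distrib)
    also have "\<dots> = ((\<integral>z. k (z - h) * \<psi> z \<partial>lborel) - (\<integral>z. k (z - 0) * \<psi> z \<partial>lborel)) / h"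
      using shift_int[of h] shift_int[of 0] by simp
    finally show ?thesis by (simp only: translate)
  qed
  ultimately show ?thesis by (simp add: DERIV_def)
qed

lemma kernel_integral_DERIV:
  fixes k k' \<psi> :: "real \<Rightarrow> real"
  assumes k: "\<And>z. (k has_real_derivative k' z) (at z)"
    and k_bound: "\<And>z. \<bar>k z\<bar> \<le> (1 + z\<^sup>2) * gauss z"
    and k'_bound: "\<And>z. \<bar>k' z\<bar> \<le> (1 + z\<^sup>2) * gauss z"
    and k'm: "k' \<in> borel_measurable borel" and \<psi>m: "\<psi> \<in> borel_measurable borel"
    and \<psi>: "\<And>z. \<bar>\<psi> z\<bar> \<le> A + B * \<bar>z\<bar>"
  shows "((\<lambda>t. \<integral>z. k z * \<psi> (z + t) \<partial>lborel) has_real_derivative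
    - (\<integral>z. k' z * \<psi> (z + t) \<partial>lborel)) (at t)"
proof -
  have "((\<lambda>s. \<integral>z. k z * \<psi> ((z + s) + t) \<partial>lborel) has_real_derivative
    - (\<integral>z. k' z * \<psi> (z + t) \<partial>lborel)) (at 0)"
    by (rule kernel_integral_DERIV_0[OF k k_bound k'_bound k'm _ linear_growth_shift[OF \<psi>]])
      (use \<psi>m in simp)
  then have "((\<lambda>s. \<integral>z. k z * \<psi> (z + (s + t)) \<partial>lborel) has_real_derivative
    - (\<integral>z. k' z * \<psi> (z + t) \<partial>lborel)) (at 0)"
    by (simp add: add.assoc)
  then show ?thesis
    using DERIV_shift[of "\<lambda>t. \<integral>z. k z * \<psi> (z + t) \<partial>lborel" _ 0 t] by simp
qed

text \<open>Up to sign, these kernels are the Gaussian and its first two derivatives; one common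
  majorant lets the differentiation lemma be applied twice.\<close>

lemma gauss_kernel_bounds:
  "\<bar>gauss z\<bar> \<le> (1 + z\<^sup>2) * gauss z" "\<bar>z * gauss z\<bar> \<le> (1 + z\<^sup>2) * gauss z"
  "\<bar>(z\<^sup>2 - 1) * gauss z\<bar> \<le> (1 + z\<^sup>2) * gauss z"
proof -
  have "0 \<le> (\<bar>z\<bar> - 1)\<^sup>2" by simp
  then have "2 * \<bar>z\<bar> \<le> 1 + z\<^sup>2" by (simp only: power2_diff) simp
  then have "\<bar>z\<bar> \<le> 1 + z\<^sup>2" using abs_ge_zero[of z] by linarith
  moreover have "\<bar>z\<^sup>2 - 1\<bar> \<le> 1 + z\<^sup>2" by (simp add: abs_le_iff)
  ultimately show "\<bar>gauss z\<bar> \<le> (1 + z\<^sup>2) * gauss z" "\<bar>z * gauss z\<bar> \<le> (1 + z\<^sup>2) * gauss z"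
    "\<bar>(z\<^sup>2 - 1) * gauss z\<bar> \<le> (1 + z\<^sup>2) * gauss z"
    by (auto simp: abs_mult intro!: mult_right_mono) (simp add: distrib_right)
qed

section \<open>The heat flow of a Lipschitz function\<close>

definition heat :: "(real \<Rightarrow> real) \<Rightarrow> real \<Rightarrow> real \<Rightarrow> real" where
  "heat \<phi> v x = (\<integral>z. gauss z * \<phi> (x + sqrt v * z) \<partial>lborel)"

text \<open>For \<open>v > 0\<close> the derivatives in \<open>x\<close> fall on the Gaussian and
  produce the Hermite polynomials \<open>z\<close> and \<open>z\<^sup>2 - 1\<close>, each with a
  factor \<open>1 / sqrt v\<close>. No derivative of \<phi> appears.\<close>

definition heat1 :: "(real \<Rightarrow> real) \<Rightarrow> real \<Rightarrow> real \<Rightarrow> real" where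
  "heat1 \<phi> v x = (\<integral>z. z * gauss z * \<phi> (x + sqrt v * z) \<partial>lborel) / sqrt v"

definition heat2 :: "(real \<Rightarrow> real) \<Rightarrow> real \<Rightarrow> real \<Rightarrow> real" where
  "heat2 \<phi> v x = (\<integral>z. (z\<^sup>2 - 1) * gauss z * \<phi> (x + sqrt v * z) \<partial>lborel) / v"

lemma heat_0: "heat \<phi> 0 x = \<phi> x"
  by (simp add: heat_def)

context
  fixes L :: real and \<phi> :: "real \<Rightarrow> real"
  assumes lip: "L-lipschitz_on UNIV \<phi>"
begin

lemma lipschitz_const_nonneg: "0 \<le> L"
  by (rule lipschitz_on_nonneg[OF lip])

lemma lipschitz_abs_le: "\<bar>\<phi> x - \<phi> y\<bar> \<le> L * \<bar>x - y\<bar>"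
  using lipschitz_onD[OF lip, of x y] by (simp add: dist_real_def)

lemma lipschitz_measurable: "\<phi> \<in> borel_measurable borel"
  by (rule borel_measurable_continuous_onI[OF lipschitz_on_continuous_on[OF lip]])

lemma lipschitz_growth: "\<bar>\<phi> (x + c * z)\<bar> \<le> (\<bar>\<phi> x\<bar>) + (L * \<bar>c\<bar>) * \<bar>z\<bar>"
  using lipschitz_abs_le[of "x + c * z" x] by (simp add: abs_mult mult.assoc)

lemma kernel_integrable:
  assumes "k \<in> borel_measurable borel" "\<And>z. \<bar>k z\<bar> \<le> (1 + z\<^sup>2) * gauss z"
  shows "integrable lborel (\<lambda>z. k z * \<phi> (x + c * z))"
  by (rule linear_growth_integrable[OF assms(1) _ lipschitz_growth assms(2)]) (use lipschitz_measurable in simp)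

lemma gauss_integrable: "integrable lborel (\<lambda>z. gauss z * \<phi> (x + c * z))"
  by (rule kernel_integrable) (simp_all only: gauss_kernel_bounds, measurable)

lemma heat_lipschitz: "L-lipschitz_on UNIV (heat \<phi> v)"
proof (rule lipschitz_onI[OF _ lipschitz_const_nonneg])
  fix x y
  have "\<bar>heat \<phi> v x - heat \<phi> v y\<bar> = \<bar>\<integral>z. gauss z * (\<phi> (x + sqrt v * z) - \<phi> (y + sqrt v * z)) \<partial>lborel\<bar>"
    unfolding heat_def using gauss_integrable by (simp add: right_diff_distrib)
  also have "\<dots> \<le> (\<integral>z. \<bar>gauss z * (\<phi> (x + sqrt v * z) - \<phi> (y + sqrt v * z))\<bar> \<partial>lborel)"
    by (rule integral_abs_bound)
  also have "\<dots> \<le> (\<integral>z. gauss z * (L * \<bar>x - y\<bar>) \<partial>lborel)"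
  proof (rule integral_mono)
    show "integrable lborel (\<lambda>z. \<bar>gauss z * (\<phi> (x + sqrt v * z) - \<phi> (y + sqrt v * z))\<bar>)"
      using gauss_integrable by (simp add: right_diff_distrib)
    show "\<bar>gauss z * (\<phi> (x + sqrt v * z) - \<phi> (y + sqrt v * z))\<bar> \<le> gauss z * (L * \<bar>x - y\<bar>)" for z
      using lipschitz_abs_le[of "x + sqrt v * z" "y + sqrt v * z"] by (simp add: abs_mult mult_left_mono)
  qed simp
  also have "\<dots> = L * \<bar>x - y\<bar>" by simp
  finally show "dist (heat \<phi> v x) (heat \<phi> v y) \<le> L * dist x y" by (simp add: dist_real_def)
qed

lemma heat_diff_le: 
  assumes "0 \<le> v"
  shows "\<bar>heat \<phi> v x - \<phi> x\<bar> \<le> L * sqrt v"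
proof -
  have "\<bar>heat \<phi> v x - \<phi> x\<bar> = \<bar>\<integral>z. gauss z * (\<phi> (x + sqrt v * z) - \<phi> x) \<partial>lborel\<bar>"
    unfolding heat_def using gauss_integrable by (simp add: right_diff_distrib)
  also have "\<dots> \<le> (\<integral>z. \<bar>gauss z * (\<phi> (x + sqrt v * z) - \<phi> x)\<bar> \<partial>lborel)"
    by (rule integral_abs_bound)
  also have "\<dots> \<le> (\<integral>z. L * sqrt v * (gauss z * \<bar>z\<bar>) \<partial>lborel)"
  proof (rule integral_mono)
    show "integrable lborel (\<lambda>z. \<bar>gauss z * (\<phi> (x + sqrt v * z) - \<phi> x)\<bar>)"
      using gauss_integrable by (simp add: right_diff_distrib)
    show "integrable lborel (\<lambda>z. L * sqrt v * (gauss z * \<bar>z\<bar>))"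
      by (intro integrable_mult_right gauss_moment_integrable)
    show "\<bar>gauss z * (\<phi> (x + sqrt v * z) - \<phi> x)\<bar> \<le> L * sqrt v * (gauss z * \<bar>z\<bar>)" for z
    proof -
      have "\<bar>\<phi> (x + sqrt v * z) - \<phi> x\<bar> \<le> L * (sqrt v * \<bar>z\<bar>)"
        using lipschitz_abs_le[of "x + sqrt v * z" x] assms by (simp add: abs_mult)
      from mult_left_mono[OF this, of "gauss z"] show ?thesis
        by (simp add: abs_mult mult_ac)
    qed
  qed
  also have "\<dots> = L * sqrt v * (\<integral>z. gauss z * \<bar>z\<bar> \<partial>lborel)" by simp
  also have "\<dots> \<le> L * sqrt v * 1"
    using lipschitz_const_nonneg assms by (intro mult_left_mono gauss_moments) auto
  finally show ?thesis by simp
qed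

lemma heat_convex:
  assumes conv: "convex_on UNIV \<phi>"
  shows "convex_on UNIV (heat \<phi> v)"
proof (rule convex_onI)
  fix t x y :: real assume t: "0 < t" "t < 1"
  have "heat \<phi> v ((1 - t) *\<^sub>R x + t *\<^sub>R y)
      \<le> (\<integral>z. (1 - t) * (gauss z * \<phi> (x + sqrt v * z)) + t * (gauss z * \<phi> (y + sqrt v * z)) \<partial>lborel)"
    unfolding heat_def
  proof (rule integral_mono)
    show "integrable lborel (\<lambda>z. gauss z * \<phi> ((1 - t) *\<^sub>R x + t *\<^sub>R y + sqrt v * z))"
      by (rule gauss_integrable)
    show "integrable lborel (\<lambda>z. (1 - t) * (gauss z * \<phi> (x + sqrt v * z)) + t * (gauss z * \<phi> (y + sqrt v * z)))"
      by (intro Bochner_Integration.integrable_add integrable_mult_right gauss_integrable)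
    fix z
    have "(1 - t) *\<^sub>R x + t *\<^sub>R y + sqrt v * z = (1 - t) *\<^sub>R (x + sqrt v * z) + t *\<^sub>R (y + sqrt v * z)"
      by (simp add: algebra_simps)
    then have "\<phi> ((1 - t) *\<^sub>R x + t *\<^sub>R y + sqrt v * z) \<le> (1 - t) * \<phi> (x + sqrt v * z) + t * \<phi> (y + sqrt v * z)"
      using convex_onD[OF conv, of t "x + sqrt v * z" "y + sqrt v * z"] t by simp
    from mult_left_mono[OF this, of "gauss z"]
    show "gauss z * \<phi> ((1 - t) *\<^sub>R x + t *\<^sub>R y + sqrt v * z)
        \<le> (1 - t) * (gauss z * \<phi> (x + sqrt v * z)) + t * (gauss z * \<phi> (y + sqrt v * z))"
      by (simp add: algebra_simps)
  qed
  also have "\<dots> = (1 - t) * heat \<phi> v x + t * heat \<phi> v y"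
    unfolding heat_def using gauss_integrable by simp
  finally show "heat \<phi> v ((1 - t) *\<^sub>R x + t *\<^sub>R y) \<le> (1 - t) * heat \<phi> v x + t * heat \<phi> v y" .
qed simp

lemma heat_DERIV:
  assumes v: "0 < v"
  shows "(heat \<phi> v has_real_derivative heat1 \<phi> v x) (at x)"
    and "(heat1 \<phi> v has_real_derivative heat2 \<phi> v x) (at x)"
proof -
  \<comment> \<open>In units of \<open>sqrt v\<close> the point \<open>x\<close> becomes a
    translation by \<open>x / sqrt v\<close>, the form that \<open>kernel_integral_DERIV\<close>
    handles.\<close>
  define \<psi> where "\<psi> = (\<lambda>z. \<phi> (sqrt v * z))"
  have \<psi>m: "\<psi> \<in> borel_measurable borel" unfolding \<psi>_def using lipschitz_measurable by simp
  have \<psi>: "\<bar>\<psi> z\<bar> \<le> \<bar>\<phi> 0\<bar> + (L * \<bar>sqrt v\<bar>) * \<bar>z\<bar>" for z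
    using lipschitz_growth[of 0 "sqrt v" z] by (simp add: \<psi>_def)
  have eq: "\<phi> (x + sqrt v * z) = \<psi> (z + x / sqrt v)" for x z
    using v by (simp add: \<psi>_def distrib_left add.commute)
  have div: "((\<lambda>x. x / sqrt v) has_real_derivative 1 / sqrt v) (at x)"
    using DERIV_cdivide[OF DERIV_ident] .
  have 1: "((\<lambda>t. \<integral>z. gauss z * \<psi> (z + t) \<partial>lborel) has_real_derivative
      - (\<integral>z. - (z * gauss z) * \<psi> (z + t) \<partial>lborel)) (at t)" for t
    by (rule kernel_integral_DERIV[OF gauss_DERIV _ _ _ \<psi>m \<psi>])
      (simp_all only: abs_minus_cancel gauss_kernel_bounds, measurable)
  have k2: "((\<lambda>z. z * gauss z) has_real_derivative - ((z\<^sup>2 - 1) * gauss z)) (at z)" for z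
    by (auto intro!: derivative_eq_intros gauss_DERIV simp: power2_eq_square algebra_simps)
  have 2: "((\<lambda>t. \<integral>z. z * gauss z * \<psi> (z + t) \<partial>lborel) has_real_derivative
      - (\<integral>z. - ((z\<^sup>2 - 1) * gauss z) * \<psi> (z + t) \<partial>lborel)) (at t)" for t
    by (rule kernel_integral_DERIV[OF k2 _ _ _ \<psi>m \<psi>])
      (simp_all only: abs_minus_cancel gauss_kernel_bounds, measurable)
  show "(heat \<phi> v has_real_derivative heat1 \<phi> v x) (at x)"
    using DERIV_chain2[OF 1 div] by (simp add: heat_def[abs_def] heat1_def eq)
  have "((\<lambda>x. (\<integral>z. z * gauss z * \<psi> (z + x / sqrt v) \<partial>lborel) / sqrt v) has_real_derivative
      (\<integral>z. (z\<^sup>2 - 1) * gauss z * \<psi> (z + x / sqrt v) \<partial>lborel) * (1 / sqrt v) / sqrt v) (at x)"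
    using DERIV_cdivide[OF DERIV_chain2[OF 2 div], of "sqrt v"] by simp
  then show "(heat1 \<phi> v has_real_derivative heat2 \<phi> v x) (at x)"
    using v by (simp add: heat1_def[abs_def] heat2_def eq)
qed

text \<open>
  This replaces a bound on the third derivative: shifting \<open>\<phi>\<close> inside the integral costs only
  the Lipschitz constant and the first absolute moment of \<open>z\<^sup>2 - 1\<close>.
\<close>

lemma heat2_lipschitz:
  assumes v: "0 < v"
  shows "\<bar>heat2 \<phi> v x - heat2 \<phi> v y\<bar> \<le> 2 * L / v * \<bar>x - y\<bar>"
proof -
  let ?k = "\<lambda>z. (z\<^sup>2 - 1) * gauss z"
  have i: "integrable lborel (\<lambda>z. ?k z * \<phi> (x + sqrt v * z))" for x
    by (rule kernel_integrable) (simp_all only: gauss_kernel_bounds, measurable)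
  have "v * \<bar>heat2 \<phi> v x - heat2 \<phi> v y\<bar> = \<bar>\<integral>z. ?k z * (\<phi> (x + sqrt v * z) - \<phi> (y + sqrt v * z)) \<partial>lborel\<bar>"
    using i v unfolding heat2_def
    by (simp add: right_diff_distrib diff_divide_distrib[symmetric])
  also have "\<dots> \<le> (\<integral>z. \<bar>?k z * (\<phi> (x + sqrt v * z) - \<phi> (y + sqrt v * z))\<bar> \<partial>lborel)"
    by (rule integral_abs_bound)
  \<comment> \<open>The 2 in the Lipschitz constant is the Gaussian integral of
    \<open>1 + z\<^sup>2\<close>, which dominates the absolute value of
    \<open>z\<^sup>2 - 1\<close>.\<close>
  also have "\<dots> \<le> (\<integral>z. (gauss z + gauss z * z\<^sup>2) * (L * \<bar>x - y\<bar>) \<partial>lborel)"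
  proof (rule integral_mono)
    show "integrable lborel (\<lambda>z. \<bar>?k z * (\<phi> (x + sqrt v * z) - \<phi> (y + sqrt v * z))\<bar>)"
      using i by (simp add: right_diff_distrib)
    show "integrable lborel (\<lambda>z. (gauss z + gauss z * z\<^sup>2) * (L * \<bar>x - y\<bar>))"
      using gauss_moment_integrable by simp
    show "\<bar>?k z * (\<phi> (x + sqrt v * z) - \<phi> (y + sqrt v * z))\<bar>
        \<le> (gauss z + gauss z * z\<^sup>2) * (L * \<bar>x - y\<bar>)" for z
    proof -
      have "gauss z + gauss z * z\<^sup>2 = (1 + z\<^sup>2) * gauss z" by (simp add: algebra_simps)
      then show ?thesis
        using mult_mono[OF gauss_kernel_bounds(3)[of z] lipschitz_abs_le[of "x + sqrt v * z" "y + sqrt v * z"]]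
        by (simp add: abs_mult)
    qed
  qed
  also have "\<dots> = (\<integral>z. gauss z + gauss z * z\<^sup>2 \<partial>lborel) * (L * \<bar>x - y\<bar>)" by simp
  also have "\<dots> = 2 * (L * \<bar>x - y\<bar>)"
    using gauss_moments gauss_moment_integrable by simp
  finally show ?thesis using v by (simp add: field_simps)
qed

text \<open>A sum of independent centred normal variables is normal with the added variance. The
  independent pair is realised by the two coordinates of a product of standard Gaussian measures,
  and Fubini turns the double integral into iterated smoothing.\<close>

lemma heat_semigroup:
  assumes "0 \<le> v" "0 \<le> s"
  shows "heat (heat \<phi> v) s x = heat \<phi> (v + s) x"
proof (cases "v = 0 \<or> s = 0")
  \<comment> \<open>The normal densities used for the sum require positive deviations, so zero
    variance is settled directly.\<close>
  case True
  have "heat \<phi> 0 = \<phi>" by (rule ext) (rule heat_0)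
  with True show ?thesis by (auto simp: heat_0)
next
  case False
  with assms have pos: "0 < sqrt v" "0 < sqrt s" by auto
  have heat_m: "heat \<phi> v \<in> borel_measurable borel"
    by (rule borel_measurable_continuous_onI[OF lipschitz_on_continuous_on[OF heat_lipschitz]])
  define G where "G = density lborel (\<lambda>x. ennreal (gauss x))"
  interpret G: prob_space G unfolding G_def by (rule prob_space_normal_density) simp
  interpret GG: pair_prob_space G G ..
  have sG[simp]: "sets G = sets borel" "space G = UNIV" by (simp_all add: G_def)
  have mG[measurable_cong]: "sets G = sets borel" by simp
  have fst_G: "distr (G \<Otimes>\<^sub>M G) G fst = G" by (rule G.distr_pair_fst)
  have snd_G: "distr (G \<Otimes>\<^sub>M G) G snd = G"
    by (subst GG.distr_pair_swap) (simp add: distr_distr o_def fst_G split_beta')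
  \<comment> \<open>\<open>distributed\<close> refers to \<open>lborel\<close>, independence to
    \<open>borel\<close>, and the projections of the product to \<open>G\<close>; these have the
    same measurable sets, so the push-forwards agree.\<close>
  have marginal: "distr (G \<Otimes>\<^sub>M G) N h = distr (G \<Otimes>\<^sub>M G) G h" if "sets N = sets borel"
    for N and h :: "real \<times> real \<Rightarrow> real"
    by (rule distr_cong) (use that in auto)
  have dfst: "distributed (G \<Otimes>\<^sub>M G) lborel fst (\<lambda>x. ennreal (gauss x))"
    unfolding distributed_def marginal[OF sets_lborel] fst_G
    by (intro conjI G_def) measurable
  have dsnd: "distributed (G \<Otimes>\<^sub>M G) lborel snd (\<lambda>x. ennreal (gauss x))"
    unfolding distributed_def marginal[OF sets_lborel] snd_G
    by (intro conjI G_def) measurable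
  have d1: "distributed (G \<Otimes>\<^sub>M G) lborel (\<lambda>p. sqrt s * fst p) (normal_density 0 (sqrt s))"
    using GG.normal_density_affine[OF dfst, of "sqrt s" 0] pos by simp
  have d2: "distributed (G \<Otimes>\<^sub>M G) lborel (\<lambda>p. sqrt v * snd p) (normal_density 0 (sqrt v))"
    using GG.normal_density_affine[OF dsnd, of "sqrt v" 0] pos by simp
  have "GG.indep_var borel fst borel snd"
    unfolding GG.indep_var_distribution_eq
  proof (intro conjI)
    have "G \<Otimes>\<^sub>M G = distr (G \<Otimes>\<^sub>M G) (borel \<Otimes>\<^sub>M borel) (\<lambda>x. (fst x, snd x))"
      using distr_id2[OF sets_pair_measure_cong[OF sG(1) sG(1), symmetric]] by simp
    then show "distr (G \<Otimes>\<^sub>M G) borel fst \<Otimes>\<^sub>M distr (G \<Otimes>\<^sub>M G) borel snd =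
      distr (G \<Otimes>\<^sub>M G) (borel \<Otimes>\<^sub>M borel) (\<lambda>x. (fst x, snd x))"
      unfolding marginal[OF refl] fst_G snd_G .
  qed measurable
  then have "GG.indep_var borel ((\<lambda>a. sqrt s * a) \<circ> fst) borel ((\<lambda>b. sqrt v * b) \<circ> snd)"
    by (rule GG.indep_var_compose) auto
  then have ind: "GG.indep_var borel (\<lambda>p. sqrt s * fst p) borel (\<lambda>p. sqrt v * snd p)"
    by (simp add: o_def)
  have "distributed (G \<Otimes>\<^sub>M G) lborel (\<lambda>p. sqrt s * fst p + sqrt v * snd p) (normal_density 0 (sqrt (s + v)))"
    using GG.add_indep_normal[OF ind pos(2,1) d1 d2] assms by simp
  then have "distributed (G \<Otimes>\<^sub>M G) lborel (\<lambda>p. (sqrt s * fst p + sqrt v * snd p) / sqrt (s + v)) gauss"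
    using GG.normal_standard_normal_convert[of "sqrt (s + v)" _ 0] pos assms by (simp add: add_pos_pos)
  from distributed_integral[OF this, of "\<lambda>z. \<phi> (x + sqrt (v + s) * z)"] lipschitz_measurable
  have "heat \<phi> (v + s) x = (\<integral>p. \<phi> (x + sqrt (v + s) * ((sqrt s * fst p + sqrt v * snd p) / sqrt (s + v))) \<partial>(G \<Otimes>\<^sub>M G))"
    by (simp add: heat_def)
  also have "\<dots> = (\<integral>p. \<phi> (x + sqrt s * fst p + sqrt v * snd p) \<partial>(G \<Otimes>\<^sub>M G))"
    using pos assms False by (intro Bochner_Integration.integral_cong) (auto simp: add.commute add.left_commute)
  also have "\<dots> = (\<integral>a. (\<integral>b. \<phi> (x + sqrt s * a + sqrt v * b) \<partial>G) \<partial>G)"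
  proof -
    \<comment> \<open>Fubini needs joint integrability, which follows from linear growth and the
      first absolute moments of both coordinates.\<close>
    have int: "integrable (G \<Otimes>\<^sub>M G) (\<lambda>p. \<phi> (x + sqrt s * fst p + sqrt v * snd p))"
    proof (rule Bochner_Integration.integrable_bound)
      have "integrable (G \<Otimes>\<^sub>M G) (\<lambda>p. \<bar>fst p\<bar>)" "integrable (G \<Otimes>\<^sub>M G) (\<lambda>p. \<bar>snd p\<bar>)"
        using distributed_integrable[OF dfst, of abs] distributed_integrable[OF dsnd, of abs]
          gauss_moment_integrable(3) by simp_all
      then show "integrable (G \<Otimes>\<^sub>M G) (\<lambda>p. \<bar>\<phi> x\<bar> + L * sqrt s * \<bar>fst p\<bar> + L * sqrt v * \<bar>snd p\<bar>)"
        by simp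
      show "(\<lambda>p. \<phi> (x + sqrt s * fst p + sqrt v * snd p)) \<in> borel_measurable (G \<Otimes>\<^sub>M G)"
        using lipschitz_measurable by measurable
      show "AE p in G \<Otimes>\<^sub>M G. norm (\<phi> (x + sqrt s * fst p + sqrt v * snd p))
          \<le> norm (\<bar>\<phi> x\<bar> + L * sqrt s * \<bar>fst p\<bar> + L * sqrt v * \<bar>snd p\<bar>)"
      proof (rule AE_I2)
        fix p :: "real \<times> real"
        have "\<bar>\<phi> (x + sqrt s * fst p + sqrt v * snd p) - \<phi> x\<bar> \<le> L * \<bar>sqrt s * fst p + sqrt v * snd p\<bar>"
          using lipschitz_abs_le[of "x + sqrt s * fst p + sqrt v * snd p" x] by (simp add: add.assoc)
        also have "\<dots> \<le> L * (sqrt s * \<bar>fst p\<bar> + sqrt v * \<bar>snd p\<bar>)"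
          using assms lipschitz_const_nonneg
          by (intro mult_left_mono order_trans[OF abs_triangle_ineq]) (auto simp: abs_mult)
        also have "\<dots> = L * sqrt s * \<bar>fst p\<bar> + L * sqrt v * \<bar>snd p\<bar>"
          by (simp only: distrib_left mult.assoc)
        finally have "\<bar>\<phi> (x + sqrt s * fst p + sqrt v * snd p)\<bar>
          \<le> \<bar>\<phi> x\<bar> + L * sqrt s * \<bar>fst p\<bar> + L * sqrt v * \<bar>snd p\<bar>"
          using abs_triangle_ineq2[of "\<phi> (x + sqrt s * fst p + sqrt v * snd p)" "\<phi> x"] by linarith
        then show "norm (\<phi> (x + sqrt s * fst p + sqrt v * snd p))
          \<le> norm (\<bar>\<phi> x\<bar> + L * sqrt s * \<bar>fst p\<bar> + L * sqrt v * \<bar>snd p\<bar>)"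
          unfolding real_norm_def by (rule order_trans[OF _ abs_ge_self])
      qed
    qed
    show ?thesis using GG.integral_fst'[OF int] by simp
  qed
  also have "\<dots> = (\<integral>a. heat \<phi> v (x + sqrt s * a) \<partial>G)"
    unfolding heat_def G_def using lipschitz_measurable
    by (subst (2) integral_real_density) auto
  also have "\<dots> = heat (heat \<phi> v) s x"
    unfolding heat_def[of "heat \<phi> v"] G_def using heat_m
    by (subst integral_real_density) simp_all
  finally show ?thesis by simp
qed

end

text \<open>The Gaussian half of the comparison: the linear term integrates to 0, the quadratic one
  to the variance, and the bound 2 on the third absolute moment turns \<open>K / 6\<close> into
  \<open>K / 3\<close>.\<close>

lemma heat_second_order_error:
  assumes f: "\<And>x. (f has_real_derivative f' x) (at x)"
    and f': "\<And>x. (f' has_real_derivative f'' x) (at x)"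
    and f'': "\<And>x y. \<bar>f'' x - f'' y\<bar> \<le> K * \<bar>x - y\<bar>"
    and lip: "L-lipschitz_on UNIV f" and s: "0 \<le> s"
  shows "\<bar>heat f (s\<^sup>2) x - (f x + f'' x * s\<^sup>2 / 2)\<bar> \<le> K * s ^ 3 / 3"
proof -
  have K: "0 \<le> K" using f''[of 1 0] by simp
  let ?r = "\<lambda>z. f (x + s * z) - f x - f' x * (s * z) - f'' x * (s * z)\<^sup>2 / 2"
  have eq: "gauss z * ?r z = gauss z * f (x + s * z) - f x * gauss z - f' x * s * (gauss z * z)
     - f'' x * s\<^sup>2 / 2 * (gauss z * z\<^sup>2)" for z
    by (simp add: algebra_simps power2_eq_square)
  note ints = gauss_integrable[OF lip] gauss_moment_integrable
  have "heat f (s\<^sup>2) x - (f x + f'' x * s\<^sup>2 / 2) = (\<integral>z. gauss z * ?r z \<partial>lborel)"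
    unfolding eq heat_def using s ints by (simp add: gauss_moments)
  then have "\<bar>heat f (s\<^sup>2) x - (f x + f'' x * s\<^sup>2 / 2)\<bar> \<le> (\<integral>z. \<bar>gauss z * ?r z\<bar> \<partial>lborel)"
    by simp
  also have "\<dots> \<le> (\<integral>z. K * s ^ 3 / 6 * (gauss z * \<bar>z\<bar> ^ 3) \<partial>lborel)"
  proof (rule integral_mono)
    show "integrable lborel (\<lambda>z. \<bar>gauss z * ?r z\<bar>)" unfolding eq using ints by simp
    show "integrable lborel (\<lambda>z. K * s ^ 3 / 6 * (gauss z * \<bar>z\<bar> ^ 3))" using ints by simp
    show "\<bar>gauss z * ?r z\<bar> \<le> K * s ^ 3 / 6 * (gauss z * \<bar>z\<bar> ^ 3)" for z
    proof -
      have "\<bar>?r z\<bar> \<le> K * s ^ 3 / 6 * \<bar>z\<bar> ^ 3"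
        using taylor2[OF f f' f'', of x "s * z"] s by (simp add: abs_mult power_mult_distrib)
      from mult_left_mono[OF this, of "gauss z"] show ?thesis
        by (simp only: abs_mult[of "gauss z"]) (simp add: mult_ac)
    qed
  qed
  also have "\<dots> = K * s ^ 3 / 6 * (\<integral>z. gauss z * \<bar>z\<bar> ^ 3 \<partial>lborel)" by simp
  also have "\<dots> \<le> K * s ^ 3 / 6 * 2"
    using K s by (intro mult_left_mono gauss_moments) auto
  finally show ?thesis by simp
qed

subsection \<open>The bound\<close>

context sublinear_expectation_space
begin

section \<open>Moment inequalities and the one-step estimate\<close>

lemma E_add_cmult_le:
  assumes "X \<in> L1" "Y \<in> L1" "0 \<le> a" "0 \<le> b"
  shows "E (\<lambda>\<omega>. a * X \<omega> + b * Y \<omega>) \<le> a * E X + b * E Y"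
  using E_add_le[OF L1_cmult[OF assms(1)] L1_cmult[OF assms(2)], of a b] assms by (simp add: E_cmult)

text \<open>Cauchy-Schwarz through a pointwise AM-GM inequality, for which monotonicity and
  sublinearity suffice. The optimal parameter is \<open>s\<close>; \<open>d = s + e\<close> avoids
  dividing by 0.\<close>

lemma absolute_moment_le:
  assumes m: "Y \<in> borel_measurable M" and Y2: "(\<lambda>\<omega>. (Y \<omega>)\<^sup>2) \<in> L1"
    and s: "E (\<lambda>\<omega>. (Y \<omega>)\<^sup>2) = s\<^sup>2" "0 \<le> s"
  shows "E (\<lambda>\<omega>. \<bar>Y \<omega>\<bar>) \<le> s"
proof (rule field_le_epsilon)
  fix e :: real assume e: "0 < e"
  define d where "d = s + e"
  have d: "0 < d" using e s by (simp add: d_def)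
  have "E (\<lambda>\<omega>. \<bar>Y \<omega>\<bar>) \<le> E (\<lambda>\<omega>. 1 / (2 * d) * (Y \<omega>)\<^sup>2 + d / 2 * 1)"
  proof (rule E_mono[OF L1_abs[OF L2_L1[OF m Y2]]])
    show "(\<lambda>\<omega>. 1 / (2 * d) * (Y \<omega>)\<^sup>2 + d / 2 * 1) \<in> L1" by (intro L1_intros Y2)
    fix \<omega>
    have "0 \<le> (\<bar>Y \<omega>\<bar> - d)\<^sup>2" by simp
    then have "2 * d * \<bar>Y \<omega>\<bar> \<le> (Y \<omega>)\<^sup>2 + d\<^sup>2"
      by (simp only: power2_diff) (simp add: mult_ac)
    then show "\<bar>Y \<omega>\<bar> \<le> 1 / (2 * d) * (Y \<omega>)\<^sup>2 + d / 2 * 1"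
      using d by (simp add: field_simps power2_eq_square)
  qed
  also have "\<dots> \<le> 1 / (2 * d) * s\<^sup>2 + d / 2 * 1"
    using E_add_cmult_le[OF Y2 L1_const[of 1], of "1 / (2 * d)" "d / 2"] d s by (simp add: E_const)
  also have "\<dots> \<le> 1 / (2 * d) * d\<^sup>2 + d / 2 * 1"
    using d s e by (intro add_mono mult_left_mono power_mono) (auto simp: d_def)
  also have "\<dots> = d" using d by (simp add: power2_eq_square)
  finally show "E (\<lambda>\<omega>. \<bar>Y \<omega>\<bar>) \<le> s + e" by (simp add: d_def)
qed

text \<open>Lyapunov's inequality. Dividing
  \<open>\<bar>Y\<bar> * (\<bar>Y\<bar> - s)\<^sup>2 \<ge> 0\<close> by \<open>2 * s\<close> bounds
  the square by the third and first powers, and the first absolute moment is at most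
  \<open>s\<close>.\<close>

lemma third_moment_ge:
  assumes m: "Y \<in> borel_measurable M" and Y2: "(\<lambda>\<omega>. (Y \<omega>)\<^sup>2) \<in> L1"
    and Y3: "(\<lambda>\<omega>. \<bar>Y \<omega>\<bar> ^ 3) \<in> L1"
    and s: "E (\<lambda>\<omega>. (Y \<omega>)\<^sup>2) = s\<^sup>2" "0 \<le> s"
  shows "s ^ 3 \<le> E (\<lambda>\<omega>. \<bar>Y \<omega>\<bar> ^ 3)"
proof (cases "s = 0")
  case True
  then show ?thesis using E_mono[OF L1_const[of 0] Y3] by (simp add: E_const)
next
  case False
  then have s0: "0 < s" using s by simp
  have Y1: "(\<lambda>\<omega>. \<bar>Y \<omega>\<bar>) \<in> L1" by (rule L1_abs[OF L2_L1[OF m Y2]])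
  have "s\<^sup>2 \<le> E (\<lambda>\<omega>. 1 / (2 * s) * \<bar>Y \<omega>\<bar> ^ 3 + s / 2 * \<bar>Y \<omega>\<bar>)"
    unfolding s(1)[symmetric]
  proof (rule E_mono[OF Y2])
    show "(\<lambda>\<omega>. 1 / (2 * s) * \<bar>Y \<omega>\<bar> ^ 3 + s / 2 * \<bar>Y \<omega>\<bar>) \<in> L1" by (intro L1_intros Y3 Y1)
    fix \<omega>
    have "0 \<le> \<bar>Y \<omega>\<bar> * (\<bar>Y \<omega>\<bar> - s)\<^sup>2" by simp
    also have "\<dots> = \<bar>Y \<omega>\<bar> ^ 3 - 2 * s * \<bar>Y \<omega>\<bar>\<^sup>2 + s\<^sup>2 * \<bar>Y \<omega>\<bar>"
      by (simp only: power2_diff power2_eq_square power3_eq_cube algebra_simps)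
    finally have "2 * s * (Y \<omega>)\<^sup>2 \<le> \<bar>Y \<omega>\<bar> ^ 3 + s\<^sup>2 * \<bar>Y \<omega>\<bar>" by simp
    then show "(Y \<omega>)\<^sup>2 \<le> 1 / (2 * s) * \<bar>Y \<omega>\<bar> ^ 3 + s / 2 * \<bar>Y \<omega>\<bar>"
      using s0 by (simp add: field_simps power2_eq_square)
  qed
  also have "\<dots> \<le> 1 / (2 * s) * E (\<lambda>\<omega>. \<bar>Y \<omega>\<bar> ^ 3) + s / 2 * E (\<lambda>\<omega>. \<bar>Y \<omega>\<bar>)"
    using s0 by (intro E_add_cmult_le Y3 Y1) auto
  also have "\<dots> \<le> 1 / (2 * s) * E (\<lambda>\<omega>. \<bar>Y \<omega>\<bar> ^ 3) + s / 2 * s"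
    using s0 absolute_moment_le[OF m Y2 s] by (intro add_mono mult_left_mono) auto
  finally show ?thesis using s0 by (simp add: field_simps power2_eq_square power3_eq_cube)
qed

text \<open>
  The Taylor expansion of the smoothed function pays off only when the remaining variance \<open>v\<close> is
  at least \<open>c\<^sup>2 / 2\<close>; otherwise the Lipschitz bound \<open>L * (s + c)\<close> is already small enough, since
  the third moment dominates \<open>s ^ 3\<close>.
\<close>

lemma heat_step_error:
  assumes m: "Y \<in> borel_measurable M" and Y2: "(\<lambda>\<omega>. (Y \<omega>)\<^sup>2) \<in> L1"
    and Y3: "(\<lambda>\<omega>. \<bar>Y \<omega>\<bar> ^ 3) \<in> L1"
    and mean: "\<And>\<theta>. \<theta> \<in> \<Theta> \<Longrightarrow> (\<integral>\<omega>. Y \<omega> \<partial>P \<theta>) = 0"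
    and s: "E (\<lambda>\<omega>. (Y \<omega>)\<^sup>2) = s\<^sup>2" "0 \<le> s"
    and c: "\<And>\<kappa>. 0 \<le> \<epsilon> * \<kappa> \<Longrightarrow> E (\<lambda>\<omega>. \<kappa> * (Y \<omega>)\<^sup>2) = \<kappa> * c\<^sup>2" "0 \<le> c" "c \<le> s"
    and lip: "L-lipschitz_on UNIV \<phi>" and conv: "convex_on UNIV (\<lambda>x. \<epsilon> * \<phi> x)"
    and \<epsilon>: "\<epsilon> = 1 \<or> \<epsilon> = -1" and v: "0 \<le> v"
    and nondeg: "0 < v + c\<^sup>2 \<or> E (\<lambda>\<omega>. \<bar>Y \<omega>\<bar> ^ 3) = 0"
  shows "\<bar>E (\<lambda>\<omega>. heat \<phi> v (w + Y \<omega>)) - heat \<phi> (v + c\<^sup>2) w\<bar>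
    \<le> L * ((2 * c\<^sup>2 * s + E (\<lambda>\<omega>. \<bar>Y \<omega>\<bar> ^ 3)) / (v + c\<^sup>2))"
proof -
  define f where "f = heat \<phi> v"
  define a where "a = E (\<lambda>\<omega>. \<bar>Y \<omega>\<bar> ^ 3)"
  have L: "0 \<le> L" by (rule lipschitz_on_nonneg[OF lip])
  have f: "L-lipschitz_on UNIV f" unfolding f_def by (rule heat_lipschitz[OF lip])
  have semi: "heat \<phi> (v + c\<^sup>2) w = heat f (c\<^sup>2) w"
    unfolding f_def using heat_semigroup[OF lip v, of "c\<^sup>2" w] by simp
  have Y1: "Y \<in> L1" by (rule L2_L1[OF m Y2])
  have fY: "(\<lambda>\<omega>. f (w + Y \<omega>)) \<in> L1"
    by (rule lipschitz_L1(2)[OF f]) (use m Y2 in \<open>auto intro!: L2_add intro: L1_const\<close>)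
  have s3: "s ^ 3 \<le> a" unfolding a_def by (rule third_moment_ge[OF m Y2 Y3 s])
  have a0: "0 \<le> a" using s3 s by (meson order_trans zero_le_power)
  \<comment> \<open>Both quantities are compared with \<open>f w\<close>: the sublinear one deviates
    by at most \<open>L * s\<close>, the Gaussian one by at most \<open>L * c\<close>.\<close>
  have crude: "\<bar>E (\<lambda>\<omega>. f (w + Y \<omega>)) - heat f (c\<^sup>2) w\<bar> \<le> L * (s + c)"
  proof -
    have "\<bar>E (\<lambda>\<omega>. f (w + Y \<omega>)) - E (\<lambda>\<omega>. f w)\<bar> \<le> E (\<lambda>\<omega>. L * \<bar>Y \<omega>\<bar>)"
    proof (rule E_dist[OF fY L1_const L1_cmult[OF L1_abs[OF Y1]]])
      show "\<bar>f (w + Y \<omega>) - f w\<bar> \<le> L * \<bar>Y \<omega>\<bar>" for \<omega>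
        using lipschitz_abs_le[OF f, of "w + Y \<omega>" w] by simp
    qed
    also have "\<dots> = L * E (\<lambda>\<omega>. \<bar>Y \<omega>\<bar>)" by (rule E_cmult[OF L1_abs[OF Y1] L])
    also have "\<dots> \<le> L * s" by (intro mult_left_mono absolute_moment_le[OF m Y2 s] L)
    finally show ?thesis
      using heat_diff_le[OF f, of "c\<^sup>2" w] c(2) by (simp add: E_const distrib_left)
  qed
  have "\<bar>E (\<lambda>\<omega>. f (w + Y \<omega>)) - heat f (c\<^sup>2) w\<bar> \<le> L * ((2 * c\<^sup>2 * s + a) / (v + c\<^sup>2))"
  proof (cases "0 < v + c\<^sup>2")
    case False
    \<comment> \<open>The right-hand side divides by 0 and is therefore 0, so the left-hand side
      must vanish; this is what \<open>nondeg\<close> is for.\<close>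
    have "0 \<le> v + c\<^sup>2" using v by simp
    then have z: "v + c\<^sup>2 = 0" "a = 0" using False nondeg unfolding a_def by linarith+
    then have "s ^ 3 \<le> 0" using s3 by simp
    then have "s = 0" using s by (metis antisym zero_le_power power_eq_0_iff)
    then show ?thesis using crude c z by simp
  next
    case pos: True
    show ?thesis
    proof (cases "v < c\<^sup>2 / 2")
      case True
      have c0: "0 < c\<^sup>2" using pos True by linarith
      have "c\<^sup>2 * s \<le> s\<^sup>2 * s" using c s by (intro mult_right_mono power_mono) auto
      then have "c\<^sup>2 * s \<le> a" using s3 by (simp add: power2_eq_square power3_eq_cube)
      \<comment> \<open>The product equals \<open>3 * c\<^sup>2 * s\<close>; two thirds match the
        deviation term, and the last third is covered by the third moment.\<close>
      moreover have "(s + c) * (v + c\<^sup>2) \<le> (2 * s) * (3 / 2 * c\<^sup>2)"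
        using True c s v by (intro mult_mono) auto
      ultimately have "(s + c) * (v + c\<^sup>2) \<le> 2 * c\<^sup>2 * s + a" by (simp add: algebra_simps)
      then have "s + c \<le> (2 * c\<^sup>2 * s + a) / (v + c\<^sup>2)" using pos by (simp add: field_simps)
      then have "L * (s + c) \<le> L * ((2 * c\<^sup>2 * s + a) / (v + c\<^sup>2))" using L by (rule mult_left_mono)
      with crude show ?thesis by linarith
    next
      case False
      then have v0: "0 < v" using pos by linarith
      define f' where "f' = heat1 \<phi> v"
      define f'' where "f'' = heat2 \<phi> v"
      define K where "K = 2 * L / v"
      have D: "(f has_real_derivative f' x) (at x)" "(f' has_real_derivative f'' x) (at x)" for x
        unfolding f_def f'_def f''_def by (rule heat_DERIV[OF lip v0])+
      have K: "\<bar>f'' x - f'' y\<bar> \<le> K * \<bar>x - y\<bar>" for x y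
        unfolding f''_def K_def by (rule heat2_lipschitz[OF lip v0])
      have K0: "0 \<le> K" using L v0 by (simp add: K_def)
      have "0 \<le> \<epsilon> * f'' w"
      proof (rule convex_imp_second_derivative_nonneg[of "\<lambda>x. \<epsilon> * f x" "\<lambda>x. \<epsilon> * f' x" "\<lambda>x. \<epsilon> * f'' x"])
        show "((\<lambda>x. \<epsilon> * f x) has_real_derivative \<epsilon> * f' x) (at x)"
          "((\<lambda>x. \<epsilon> * f' x) has_real_derivative \<epsilon> * f'' x) (at x)" for x
          by (intro DERIV_cmult D)+
        show "\<bar>\<epsilon> * f'' x - \<epsilon> * f'' y\<bar> \<le> K * \<bar>x - y\<bar>" for x y
          using K[of x y] \<epsilon> by (auto simp: abs_minus_commute)
        have "L-lipschitz_on UNIV (\<lambda>x. \<epsilon> * \<phi> x)" using \<epsilon> lip by auto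
        from heat_convex[OF this conv, of v] have "convex_on UNIV (heat (\<lambda>x. \<epsilon> * \<phi> x) v)" .
        also have "heat (\<lambda>x. \<epsilon> * \<phi> x) v = (\<lambda>x. \<epsilon> * f x)"
          by (rule ext) (simp add: f_def heat_def mult.left_commute)
        finally show "convex_on UNIV (\<lambda>x. \<epsilon> * f x)" .
      qed
      \<comment> \<open>The sign condition under which the expectation of the quadratic term is
        exactly its coefficient times \<open>c\<^sup>2\<close>.\<close>
      then have "0 \<le> \<epsilon> * (f'' w / 2)" by simp
      note EY2 = c(1)[OF this]
      have Qmean: "(\<integral>\<omega>. f w + f' w * Y \<omega> \<partial>P \<theta>) = f w" if t: "\<theta> \<in> \<Theta>" for \<theta>
        using L1_integrable[OF L1_const t] L1_integrable[OF Y1 t] mean[OF t]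
        by (simp add: prob[OF t] prob_space.prob_space)
      have "E (\<lambda>\<omega>. (f w + f' w * Y \<omega>) + f'' w / 2 * (Y \<omega>)\<^sup>2) = f w + E (\<lambda>\<omega>. f'' w / 2 * (Y \<omega>)\<^sup>2)"
        by (rule E_add_certain[OF _ _ Qmean]) (intro L1_intros Y1 Y2)+
      then have EQ: "E (\<lambda>\<omega>. (f w + f' w * Y \<omega>) + f'' w / 2 * (Y \<omega>)\<^sup>2) = f w + f'' w * c\<^sup>2 / 2"
        using EY2 by simp
      have "\<bar>E (\<lambda>\<omega>. f (w + Y \<omega>)) - E (\<lambda>\<omega>. (f w + f' w * Y \<omega>) + f'' w / 2 * (Y \<omega>)\<^sup>2)\<bar>
          \<le> E (\<lambda>\<omega>. K / 6 * \<bar>Y \<omega>\<bar> ^ 3)"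
      proof (rule E_dist[OF fY])
        show "\<bar>f (w + Y \<omega>) - (f w + f' w * Y \<omega> + f'' w / 2 * (Y \<omega>)\<^sup>2)\<bar> \<le> K / 6 * \<bar>Y \<omega>\<bar> ^ 3" for \<omega>
          using taylor2[OF D K, of w "Y \<omega>"] by (simp add: algebra_simps)
      qed (intro L1_intros Y1 Y2 Y3)+
      also have "\<dots> = K / 6 * a" unfolding a_def using K0 by (intro E_cmult Y3) auto
      finally have "\<bar>E (\<lambda>\<omega>. f (w + Y \<omega>)) - heat f (c\<^sup>2) w\<bar> \<le> K / 6 * a + K * c ^ 3 / 3"
        using heat_second_order_error[OF D K f c(2), of w] EQ by linarith
      also have "\<dots> = L * ((2 * c\<^sup>2 * c + a) / (3 * v))"
        using v0 by (simp add: K_def field_simps power2_eq_square power3_eq_cube)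
      \<comment> \<open>In this case \<open>c\<^sup>2 \<le> 2 * v\<close>, so
        \<open>v + c\<^sup>2 \<le> 3 * v\<close>. The threshold on \<open>v\<close> was chosen for
        this.\<close>
      also have "\<dots> \<le> L * ((2 * c\<^sup>2 * s + a) / (v + c\<^sup>2))"
        using L pos False c s a0 by (intro mult_left_mono frac_le add_mono) auto
      finally show ?thesis .
    qed
  qed
  then show ?thesis unfolding semi a_def f_def .
qed

section \<open>Telescoping over the summands\<close>

lemma lindeberg_bound:
  assumes X: "\<And>i. i \<in> {1..n} \<Longrightarrow> X i \<in> borel_measurable M" and ind: "indep_seq P \<Theta> n X"
    and X2: "\<And>i. i \<in> {1..n} \<Longrightarrow> (\<lambda>\<omega>. (X i \<omega> - \<mu>)\<^sup>2) \<in> L1"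
    and X3: "\<And>i. i \<in> {1..n} \<Longrightarrow> (\<lambda>\<omega>. \<bar>X i \<omega> - \<mu>\<bar> ^ 3) \<in> L1"
    and mean: "\<And>i \<theta>. i \<in> {1..n} \<Longrightarrow> \<theta> \<in> \<Theta> \<Longrightarrow> (\<integral>\<omega>. X i \<omega> - \<mu> \<partial>P \<theta>) = 0"
    and s: "\<And>i. i \<in> {1..n} \<Longrightarrow> E (\<lambda>\<omega>. (X i \<omega> - \<mu>)\<^sup>2) = (s i)\<^sup>2" "\<And>i. i \<in> {1..n} \<Longrightarrow> 0 \<le> s i"
    and c: "\<And>i \<kappa>. i \<in> {1..n} \<Longrightarrow> 0 \<le> \<epsilon> * \<kappa> \<Longrightarrow> E (\<lambda>\<omega>. \<kappa> * (X i \<omega> - \<mu>)\<^sup>2) = \<kappa> * (c i)\<^sup>2"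
      "\<And>i. i \<in> {1..n} \<Longrightarrow> 0 \<le> c i" "\<And>i. i \<in> {1..n} \<Longrightarrow> c i \<le> s i"
    and lip: "L-lipschitz_on UNIV \<phi>" and conv: "convex_on UNIV (\<lambda>x. \<epsilon> * \<phi> x)"
    and \<epsilon>: "\<epsilon> = 1 \<or> \<epsilon> = -1"
    and nondeg: "\<And>i. i \<in> {1..n} \<Longrightarrow> 0 < (\<Sum>j=i..n. (c j)\<^sup>2) \<or> E (\<lambda>\<omega>. \<bar>X i \<omega> - \<mu>\<bar> ^ 3) = 0"
  shows "\<bar>E (\<lambda>\<omega>. \<phi> (\<Sum>i=1..n. X i \<omega> - \<mu>)) - heat \<phi> (\<Sum>i=1..n. (c i)\<^sup>2) 0\<bar>
    \<le> L * (\<Sum>i=1..n. (2 * (c i)\<^sup>2 * s i + E (\<lambda>\<omega>. \<bar>X i \<omega> - \<mu>\<bar> ^ 3)) / (\<Sum>j=i..n. (c j)\<^sup>2))"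
proof -
  define V where "V = (\<lambda>i. \<Sum>j=Suc i..n. (c j)\<^sup>2)"
  define S where "S = (\<lambda>i \<omega>. \<Sum>j=1..i. X j \<omega> - \<mu>)"
  \<comment> \<open>Interpolates between the two sides: at \<open>n\<close> nothing is smoothed and
    the full sum remains, at 0 the sum is empty and all the variance is in the smoothing.\<close>
  define U where "U = (\<lambda>i. E (\<lambda>\<omega>. heat \<phi> (V i) (S i \<omega>)))"
  define t where "t = (\<lambda>i. (2 * (c i)\<^sup>2 * s i + E (\<lambda>\<omega>. \<bar>X i \<omega> - \<mu>\<bar> ^ 3)) / (\<Sum>j=i..n. (c j)\<^sup>2))"
  have S2: "(\<lambda>\<omega>. (S i \<omega>)\<^sup>2) \<in> L1" "S i \<in> borel_measurable M" if "i \<le> n" for i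
  proof -
    have m: "S i \<in> borel_measurable M" if "i \<le> n" for i
      unfolding S_def using X that by (intro borel_measurable_sum borel_measurable_diff) auto
    then show "S i \<in> borel_measurable M" using that .
    show "(\<lambda>\<omega>. (S i \<omega>)\<^sup>2) \<in> L1" using that
    proof (induction i)
      case 0
      then show ?case using L1_const[of 0] by (simp add: S_def)
    next
      case (Suc i)
      then have "(\<lambda>\<omega>. (S i \<omega> + (X (Suc i) \<omega> - \<mu>))\<^sup>2) \<in> L1"
        by (intro L2_add m X2) (auto intro!: borel_measurable_diff X)
      then show ?case by (simp add: S_def)
    qed
  qed
  have step: "\<bar>U (Suc i) - U i\<bar> \<le> L * t (Suc i)" if i: "i < n" for i
  proof -
    have mem: "Suc i \<in> {1..n}" using i by simp
    have V: "V i = V (Suc i) + (c (Suc i))\<^sup>2" "V i = (\<Sum>j=Suc i..n. (c j)\<^sup>2)"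
      unfolding V_def using i by (simp_all add: sum.atLeast_Suc_atMost)
    have V0: "0 \<le> V (Suc i)" unfolding V_def by (intro sum_nonneg) auto
    have one: "\<bar>E (\<lambda>\<omega>. heat \<phi> (V (Suc i)) (w + (X (i + 1) \<omega> - \<mu>))) - heat \<phi> (V i) w\<bar> \<le> L * t (Suc i)" for w
      using heat_step_error[OF borel_measurable_diff[OF X[OF mem] borel_measurable_const] X2[OF mem] X3[OF mem]
          mean[OF mem] s(1)[OF mem] s(2)[OF mem] c(1)[OF mem] c(2)[OF mem] c(3)[OF mem] lip conv \<epsilon> V0, of w]
        nondeg[OF mem]
      unfolding V(1)[symmetric] t_def V(2)[symmetric] by simp
    have S: "S (Suc i) \<omega> = S i \<omega> + (X (i + 1) \<omega> - \<mu>)" for \<omega> by (simp add: S_def)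
    show ?thesis
    proof (cases "i = 0")
      case True
      then show ?thesis using one[of 0] by (simp add: U_def S_def E_const)
    next
      case False
      have io: "indep_of P \<Theta> 1 (segment_vec X (i + 1) 1) i (segment_vec X 1 i)"
        using ind False i unfolding indep_seq_def by auto
      have "\<bar>E (\<lambda>\<omega>. heat \<phi> (V (Suc i)) ((\<Sum>j=1..i. X j \<omega> - \<mu>) + (X (i + 1) \<omega> - \<mu>))) -
          E (\<lambda>\<omega>. heat \<phi> (V i) (\<Sum>j=1..i. X j \<omega> - \<mu>))\<bar> \<le> L * t (Suc i)"
        by (rule indep_of_sum_error[OF io _ _ _ heat_lipschitz[OF lip] heat_lipschitz[OF lip] one])
          (use i X X2 S2(1)[of i] in \<open>auto simp: S_def\<close>)
      then show ?thesis unfolding U_def S unfolding S_def .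
    qed
  qed
  have "\<bar>U m - U 0\<bar> \<le> L * (\<Sum>i=1..m. t i)" if "m \<le> n" for m
    using that
  proof (induction m)
    case (Suc m)
    then show ?case using step[of m] by (simp add: distrib_left)
  qed simp
  from this[of n] show ?thesis
    by (simp add: U_def V_def S_def heat_0 E_const t_def)
qed

end

text \<open>The infimum is attained: each difference quotient is a lower bound for all admissible
  constants, hence for their infimum.\<close>

lemma lip_const_lipschitz:
  assumes "\<phi> \<in> lip" shows "(lip_const \<phi>)-lipschitz_on UNIV \<phi>"
proof (rule lipschitz_onI)
  let ?S = "{L. L-lipschitz_on UNIV \<phi>}"
  have ne: "?S \<noteq> {}" using assms by (auto simp: lip_def)
  show "0 \<le> lip_const \<phi>"
    unfolding lip_const_def using ne by (rule cInf_greatest) (auto dest: lipschitz_on_nonneg)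
  fix x y
  show "dist (\<phi> x) (\<phi> y) \<le> lip_const \<phi> * dist x y"
  proof (cases "x = y")
    case False
    then have d: "0 < dist x y" by simp
    have "dist (\<phi> x) (\<phi> y) / dist x y \<le> lip_const \<phi>"
      unfolding lip_const_def using ne
    proof (rule cInf_greatest)
      fix L assume "L \<in> ?S"
      then have "dist (\<phi> x) (\<phi> y) \<le> L * dist x y" by (auto dest: lipschitz_onD)
      then show "dist (\<phi> x) (\<phi> y) / dist x y \<le> L" using d by (simp add: field_simps)
    qed
    then show ?thesis using d by (simp add: field_simps)
  qed simp
qed

section \<open>Degenerate cases and the extended-real bound\<close>

context sublinear_expectation_space
begin

text \<open>Serves both halves of the theorem: \<epsilon> = 1 with upper deviations in
  \<open>c\<close>, \<epsilon> = -1 with lower ones. Third moments may be infinite and tail sums may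
  vanish, so the real estimate applies only after these cases are sorted out.\<close>

lemma normal_approximation_bound:
  fixes N :: "'b measure" and Z :: "'b \<Rightarrow> real"
  assumes X: "\<And>i. i \<in> {1..n} \<Longrightarrow> X i \<in> borel_measurable M" and ind: "indep_seq P \<Theta> n X"
    and up: "\<And>i. i \<in> {1..n} \<Longrightarrow> sublin_expectation P \<Theta> (X i) = ereal \<mu>"
    and lo: "\<And>i. i \<in> {1..n} \<Longrightarrow> - sublin_expectation P \<Theta> (\<lambda>\<omega>. - X i \<omega>) = ereal \<mu>"
    and s: "\<And>i. i \<in> {1..n} \<Longrightarrow> 0 \<le> s i"
      "\<And>i. i \<in> {1..n} \<Longrightarrow> sublin_expectation P \<Theta> (\<lambda>\<omega>. (X i \<omega> - \<mu>)\<^sup>2) = ereal ((s i)\<^sup>2)"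
    and c: "\<And>i. i \<in> {1..n} \<Longrightarrow> 0 \<le> c i"
      "\<And>i. i \<in> {1..n} \<Longrightarrow> sublin_expectation P \<Theta> (\<lambda>\<omega>. \<epsilon> * (X i \<omega> - \<mu>)\<^sup>2) = ereal (\<epsilon> * (c i)\<^sup>2)"
    and \<epsilon>: "\<epsilon> = 1 \<or> \<epsilon> = -1"
    and N: "prob_space N" and Z: "distributed N lborel Z std_normal_density"
    and B: "B = sqrt (\<Sum>i=1..n. (c i)\<^sup>2)" "0 < B"
    and lip: "\<phi> \<in> lip" and conv: "convex_on UNIV (\<lambda>x. \<epsilon> * \<phi> x)"
  shows "\<bar>sublin_expectation P \<Theta> (\<lambda>\<omega>. \<phi> ((\<Sum>i=1..n. X i \<omega> - \<mu>) / B))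
          - ereal (prob_space.expectation N (\<lambda>\<omega>. \<phi> (Z \<omega>)))\<bar>
       \<le> ereal (lip_const \<phi> / B) *
          (\<Sum>i=1..n.
             (ereal (2 * (c i)\<^sup>2 * s i) + sublin_expectation P \<Theta> (\<lambda>\<omega>. \<bar>X i \<omega> - \<mu>\<bar>^3))
               / ereal (\<Sum>j=i..n. (c j)\<^sup>2))"
    (is "?lhs \<le> ereal (_ / B) * (\<Sum>i=1..n. ?term i)")
proof -
  define L where "L = lip_const \<phi>"
  define Y where "Y = (\<lambda>i \<omega>. X i \<omega> - \<mu>)"
  have lip: "L-lipschitz_on UNIV \<phi>" unfolding L_def by (rule lip_const_lipschitz[OF lip])
  have L0: "0 \<le> L" by (rule lipschitz_on_nonneg[OF lip])
  have Ym: "Y i \<in> borel_measurable M" if "i \<in> {1..n}" for i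
    unfolding Y_def using X[OF that] by simp
  have Y2: "(\<lambda>\<omega>. (Y i \<omega>)\<^sup>2) \<in> L1" if i: "i \<in> {1..n}" for i
    by (rule L1_nonneg) (use Ym[OF i] s(2)[OF i] in \<open>auto simp: Y_def\<close>)
  have EY2: "E (\<lambda>\<omega>. (Y i \<omega>)\<^sup>2) = (s i)\<^sup>2" if i: "i \<in> {1..n}" for i
    using sublin_expectation_L1[OF Y2[OF i]] s(2)[OF i] by (simp add: Y_def)
  have E\<epsilon>: "E (\<lambda>\<omega>. \<epsilon> * (Y i \<omega>)\<^sup>2) = \<epsilon> * (c i)\<^sup>2" if i: "i \<in> {1..n}" for i
    using sublin_expectation_L1[OF L1_cmult[OF Y2[OF i]], of \<epsilon>] c(2)[OF i] by (simp add: Y_def)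
  have Y1: "Y i \<in> L1" if i: "i \<in> {1..n}" for i by (rule L2_L1[OF Ym[OF i] Y2[OF i]])
  have X1: "X i \<in> L1" if i: "i \<in> {1..n}" for i
    using L1_add[OF Y1[OF i] L1_const[of \<mu>]] by (simp add: Y_def)
  \<comment> \<open>Upper and lower means coincide, which pins the mean under every single
    \<theta>.\<close>
  have mean: "(\<integral>\<omega>. Y i \<omega> \<partial>P \<theta>) = 0" if i: "i \<in> {1..n}" and t: "\<theta> \<in> \<Theta>" for i \<theta>
  proof -
    have "E (X i) = \<mu>" using up[OF i] sublin_expectation_L1[OF X1[OF i]] by simp
    moreover have "E (\<lambda>\<omega>. - X i \<omega>) = - \<mu>"
      using lo[OF i] sublin_expectation_L1[OF L1_uminus[OF X1[OF i]]] by simp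
    ultimately have "(\<integral>\<omega>. X i \<omega> \<partial>P \<theta>) = \<mu>"
      using E_upper[OF X1[OF i] t] E_upper[OF L1_uminus[OF X1[OF i]] t] by simp
    then show ?thesis
      unfolding Y_def using L1_integrable[OF X1[OF i] t] L1_integrable[OF L1_const t]
      by (simp add: prob[OF t] prob_space.prob_space)
  qed
  \<comment> \<open>Positive homogeneity extends the identity from \<epsilon> to every \<kappa> of
    the same sign, written as \<open>(\<epsilon> * \<kappa>) * \<epsilon>\<close>.\<close>
  have c\<kappa>: "E (\<lambda>\<omega>. \<kappa> * (Y i \<omega>)\<^sup>2) = \<kappa> * (c i)\<^sup>2" if i: "i \<in> {1..n}" and \<kappa>: "0 \<le> \<epsilon> * \<kappa>" for i \<kappa>
  proof -
    have eq: "(\<epsilon> * \<kappa>) * (\<epsilon> * r) = \<kappa> * r" for r using \<epsilon> by auto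
    show ?thesis
      using E_cmult[OF L1_cmult[OF Y2[OF i], of \<epsilon>] \<kappa>] unfolding E\<epsilon>[OF i] eq .
  qed
  have cs: "c i \<le> s i" if i: "i \<in> {1..n}" for i
  proof -
    obtain \<theta> where t: "\<theta> \<in> \<Theta>" using nonempty by auto
    have "(c i)\<^sup>2 \<le> (s i)\<^sup>2"
      using \<epsilon>
    proof
      assume "\<epsilon> = 1"
      then show ?thesis using E\<epsilon>[OF i] EY2[OF i] by simp
    next
      assume "\<epsilon> = -1"
      then have "- (\<integral>\<omega>. (Y i \<omega>)\<^sup>2 \<partial>P \<theta>) \<le> - (c i)\<^sup>2"
        using E_upper[OF L1_uminus[OF Y2[OF i]] t] E\<epsilon>[OF i] by simp
      then show ?thesis using E_upper[OF Y2[OF i] t] EY2[OF i] by simp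
    qed
    then show ?thesis using s(1)[OF i] by (rule power2_le_imp_le)
  qed
  have tail0: "0 \<le> (\<Sum>j=i..n. (c j)\<^sup>2)" for i by (intro sum_nonneg) auto
  have S: "(\<lambda>\<omega>. \<Sum>i\<in>I. Y i \<omega>) \<in> borel_measurable M \<and> (\<lambda>\<omega>. (\<Sum>i\<in>I. Y i \<omega>)\<^sup>2) \<in> L1"
    if "I \<subseteq> {1..n}" for I
    using finite_subset[OF that finite_atLeastAtMost] that
  proof (induction I rule: finite_induct)
    case empty
    then show ?case using L1_const[of 0] by simp
  next
    case (insert i I)
    then show ?case by (auto intro!: L2_add borel_measurable_add Ym Y2)
  qed
  \<comment> \<open>The normalisation is absorbed into the function, not into the variables: the
    variances stay unscaled, \<open>1 / B\<close> reappears as a factor of the Lipschitz constant,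
    and smoothing by total variance \<open>B\<^sup>2\<close> gives back the standard Gaussian
    expectation.\<close>
  define \<phi>B where "\<phi>B = (\<lambda>x. \<phi> (x / B))"
  have lipB: "(L / B)-lipschitz_on UNIV \<phi>B"
  proof (rule lipschitz_onI)
    show "0 \<le> L / B" using L0 B by simp
    show "dist (\<phi>B x) (\<phi>B y) \<le> L / B * dist x y" for x y
      using lipschitz_abs_le[OF lip, of "x / B" "y / B"] B
      by (simp add: \<phi>B_def dist_real_def diff_divide_distrib[symmetric])
  qed
  have convB: "convex_on UNIV (\<lambda>x. \<epsilon> * \<phi>B x)"
  proof (rule convex_onI)
    fix t x y :: real assume t: "0 < t" "t < 1"
    show "\<epsilon> * \<phi>B ((1 - t) *\<^sub>R x + t *\<^sub>R y) \<le> (1 - t) * (\<epsilon> * \<phi>B x) + t * (\<epsilon> * \<phi>B y)"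
      using convex_onD[OF conv, of t "x / B" "y / B"] t by (simp add: \<phi>B_def add_divide_distrib)
  qed simp
  have lhs: "?lhs = ereal \<bar>E (\<lambda>\<omega>. \<phi>B (\<Sum>i=1..n. X i \<omega> - \<mu>)) - heat \<phi>B (\<Sum>i=1..n. (c i)\<^sup>2) 0\<bar>"
  proof -
    have "(\<lambda>\<omega>. \<phi>B (\<Sum>i=1..n. Y i \<omega>)) \<in> L1"
      by (rule lipschitz_L1(2)[OF lipB]) (use S[OF order_refl] in auto)
    from sublin_expectation_L1[OF this]
    have 1: "sublin_expectation P \<Theta> (\<lambda>\<omega>. \<phi> ((\<Sum>i=1..n. X i \<omega> - \<mu>) / B)) =
      ereal (E (\<lambda>\<omega>. \<phi>B (\<Sum>i=1..n. X i \<omega> - \<mu>)))"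
      by (simp add: \<phi>B_def Y_def)
    have "heat \<phi>B (\<Sum>i=1..n. (c i)\<^sup>2) 0 = (\<integral>z. gauss z * \<phi> z \<partial>lborel)"
      using B by (simp add: heat_def \<phi>B_def)
    also have "\<dots> = prob_space.expectation N (\<lambda>\<omega>. \<phi> (Z \<omega>))"
      by (rule distributed_integral[OF Z]) (use lipschitz_measurable[OF lip] in auto)
    finally show ?thesis using 1 by simp
  qed
  show ?thesis
  proof (cases "L = 0")
    \<comment> \<open>Separate because 0 times infinity is 0 in \<open>ereal\<close>: an infinite
      third moment would not make the bound vacuous. But \<phi> is constant here, so the left side
      is 0.\<close>
    case True
    have const: "\<phi> x = \<phi> 0" for x using lipschitz_abs_le[OF lip, of x 0] True by simp
    have \<phi>B0: "\<phi>B = (\<lambda>x. \<phi> 0)" unfolding \<phi>B_def by (rule ext) (rule const)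
    show ?thesis unfolding lhs using True by (simp add: L_def \<phi>B0 heat_def E_const zero_ereal_def[symmetric])
  next
    case False
    then have Lpos: "0 < L / B" using L0 B by simp
    let ?m = "\<lambda>i. sublin_expectation P \<Theta> (\<lambda>\<omega>. \<bar>X i \<omega> - \<mu>\<bar> ^ 3)"
    have m0: "0 \<le> ?m i" if i: "i \<in> {1..n}" for i
    proof (cases "?m i = \<infinity>")
      case False
      then have "(\<lambda>\<omega>. \<bar>X i \<omega> - \<mu>\<bar> ^ 3) \<in> L1"
        using X[OF i] by (intro L1_nonneg) auto
      then show ?thesis using E_mono[OF L1_const[of 0]] sublin_expectation_L1 by (simp add: E_const)
    qed simp
    show ?thesis
    proof (cases "\<exists>i\<in>{1..n}. ?m i = \<infinity> \<or> ((\<Sum>j=i..n. (c j)\<^sup>2) = 0 \<and> ?m i \<noteq> 0)")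
      \<comment> \<open>A positive numerator over 0 is infinite in \<open>ereal\<close>, so either
        kind of bad index makes the right-hand side infinite.\<close>
      case True
      then obtain i where i: "i \<in> {1..n}" and inf: "?m i = \<infinity> \<or> ((\<Sum>j=i..n. (c j)\<^sup>2) = 0 \<and> ?m i \<noteq> 0)"
        by auto
      have x0: "0 \<le> 2 * (c i)\<^sup>2 * s i" using s(1)[OF i] by simp
      have "?term i = \<infinity>"
      proof (cases "(\<Sum>j=i..n. (c j)\<^sup>2) = 0")
        case True
        have "0 < ?m i" using inf m0[OF i] by (auto simp: less_le)
        then have "0 < ereal (2 * (c i)\<^sup>2 * s i) + ?m i"
          using x0 by (intro add_nonneg_pos) auto
        then show ?thesis unfolding True divide_ereal_def by (simp add: zero_ereal_def[symmetric])
      next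
        case False
        then have "0 < (\<Sum>j=i..n. (c j)\<^sup>2)" using tail0[of i] by simp
        then show ?thesis using inf False by simp
      qed
      then have "(\<Sum>i=1..n. ?term i) = \<infinity>" using i by (subst sum_Pinfty) auto
      moreover have "ereal (lip_const \<phi> / B) * \<infinity> = \<infinity>" using Lpos by (auto simp: L_def)
      ultimately show ?thesis by (simp only: ereal_less_eq)
    next
      case False
      then have fin: "?m i \<noteq> \<infinity>" and deg: "(\<Sum>j=i..n. (c j)\<^sup>2) = 0 \<Longrightarrow> ?m i = 0" if "i \<in> {1..n}" for i
        using that by auto
      have Y3: "(\<lambda>\<omega>. \<bar>X i \<omega> - \<mu>\<bar> ^ 3) \<in> L1" if "i \<in> {1..n}" for i
        using X[OF that] fin[OF that] by (intro L1_nonneg) auto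
      define a where "a = (\<lambda>i. E (\<lambda>\<omega>. \<bar>X i \<omega> - \<mu>\<bar> ^ 3))"
      have ma: "?m i = ereal (a i)" if "i \<in> {1..n}" for i
        unfolding a_def by (rule sublin_expectation_L1[OF Y3[OF that]])
      have a0: "a i = 0" if "i \<in> {1..n}" "(\<Sum>j=i..n. (c j)\<^sup>2) = 0" for i
        using deg[OF that] ma[OF that(1)] by simp
      have "?term i = ereal ((2 * (c i)\<^sup>2 * s i + a i) / (\<Sum>j=i..n. (c j)\<^sup>2))" if i: "i \<in> {1..n}" for i
      proof (cases "(\<Sum>j=i..n. (c j)\<^sup>2) = 0")
        case True
        \<comment> \<open>The tail starts at \<open>i\<close> itself, so a vanishing tail forces
          \<open>c i = 0\<close>. The term is then 0 / 0, which is 0 both in \<open>ereal\<close>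
          and in the reals.\<close>
        then have "\<forall>j\<in>{i..n}. (c j)\<^sup>2 = 0" by (subst (asm) sum_nonneg_eq_0_iff) auto
        then have "c i = 0" using i by auto
        then show ?thesis unfolding ma[OF i] a0[OF i True] True by (simp add: zero_ereal_def[symmetric])
      next
        case False
        then show ?thesis unfolding ma[OF i] by simp
      qed
      then have "(\<Sum>i=1..n. ?term i) = ereal (\<Sum>i=1..n. (2 * (c i)\<^sup>2 * s i + a i) / (\<Sum>j=i..n. (c j)\<^sup>2))"
        by (subst sum_ereal[symmetric]) (rule sum.cong, auto)
      moreover have "\<bar>E (\<lambda>\<omega>. \<phi>B (\<Sum>i=1..n. X i \<omega> - \<mu>)) - heat \<phi>B (\<Sum>i=1..n. (c i)\<^sup>2) 0\<bar>
        \<le> L / B * (\<Sum>i=1..n. (2 * (c i)\<^sup>2 * s i + a i) / (\<Sum>j=i..n. (c j)\<^sup>2))"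
        unfolding a_def
      proof (rule lindeberg_bound[OF X ind Y2[unfolded Y_def] Y3 mean[unfolded Y_def] EY2[unfolded Y_def] s(1)
            c\<kappa>[unfolded Y_def] c(1) cs lipB convB \<epsilon>])
        show "0 < (\<Sum>j=i..n. (c j)\<^sup>2) \<or> E (\<lambda>\<omega>. \<bar>X i \<omega> - \<mu>\<bar> ^ 3) = 0" if "i \<in> {1..n}" for i
          using a0[OF that] tail0[of i] unfolding a_def by linarith
      qed auto
      ultimately show ?thesis unfolding lhs by (simp add: L_def)
    qed
  qed
qed

end

theorem theorem3p1:
  fixes M :: "'a measure" and P :: "'t \<Rightarrow> 'a measure" and \<Theta> :: "'t set"
    and X :: "nat \<Rightarrow> 'a \<Rightarrow> real" and n :: nat
    and \<mu> :: real and \<sigma>_up \<sigma>_lo :: "nat \<Rightarrow> real"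
    and N :: "'b measure" and Z :: "'b \<Rightarrow> real"
  assumes "\<Theta> \<noteq> {}"
    and "\<And>\<theta>. \<theta> \<in> \<Theta> \<Longrightarrow> prob_space (P \<theta>)"
    and "\<And>\<theta>. \<theta> \<in> \<Theta> \<Longrightarrow> sets (P \<theta>) = sets M"
    and "\<And>i. i \<in> {1..n} \<Longrightarrow> X i \<in> borel_measurable M"
    and "indep_seq P \<Theta> n X"
    and "\<And>i. i \<in> {1..n} \<Longrightarrow> sublin_expectation P \<Theta> (X i) = ereal \<mu>"
    and "\<And>i. i \<in> {1..n} \<Longrightarrow> - sublin_expectation P \<Theta> (\<lambda>\<omega>. - X i \<omega>) = ereal \<mu>"
    and "\<And>i. i \<in> {1..n} \<Longrightarrow> \<sigma>_up i \<ge> 0"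
    and "\<And>i. i \<in> {1..n} \<Longrightarrow> \<sigma>_lo i \<ge> 0"
    and "\<And>i. i \<in> {1..n} \<Longrightarrow>
           sublin_expectation P \<Theta> (\<lambda>\<omega>. (X i \<omega> - \<mu>)\<^sup>2) = ereal ((\<sigma>_up i)\<^sup>2)"
    and "\<And>i. i \<in> {1..n} \<Longrightarrow>
           - sublin_expectation P \<Theta> (\<lambda>\<omega>. - ((X i \<omega> - \<mu>)\<^sup>2)) = ereal ((\<sigma>_lo i)\<^sup>2)"
    and "prob_space N"
    and "distributed N lborel Z std_normal_density"
  shows
    "(\<forall>B \<phi>. B = sqrt (\<Sum>i=1..n. (\<sigma>_up i)\<^sup>2) \<and> B > 0 \<and> \<phi> \<in> lip \<and> convex_on UNIV \<phi> \<longrightarrow>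
       \<bar>sublin_expectation P \<Theta> (\<lambda>\<omega>. \<phi> ((\<Sum>i=1..n. X i \<omega> - \<mu>) / B))
          - ereal (prob_space.expectation N (\<lambda>\<omega>. \<phi> (Z \<omega>)))\<bar>
       \<le> ereal (lip_const \<phi> / B) *
          (\<Sum>i=1..n.
             (ereal (2 * (\<sigma>_up i)^3) + sublin_expectation P \<Theta> (\<lambda>\<omega>. \<bar>X i \<omega> - \<mu>\<bar>^3))
               / ereal (\<Sum>j=i..n. (\<sigma>_up j)\<^sup>2)))
     \<and>
     (\<forall>B \<phi>. B = sqrt (\<Sum>i=1..n. (\<sigma>_lo i)\<^sup>2) \<and> B > 0 \<and> \<phi> \<in> lip \<and> concave_on UNIV \<phi> \<longrightarrow>
       \<bar>sublin_expectation P \<Theta> (\<lambda>\<omega>. \<phi> ((\<Sum>i=1..n. X i \<omega> - \<mu>) / B))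
          - ereal (prob_space.expectation N (\<lambda>\<omega>. \<phi> (Z \<omega>)))\<bar>
       \<le> ereal (lip_const \<phi> / B) *
          (\<Sum>i=1..n.
             (ereal (2 * (\<sigma>_lo i)\<^sup>2 * \<sigma>_up i) + sublin_expectation P \<Theta> (\<lambda>\<omega>. \<bar>X i \<omega> - \<mu>\<bar>^3))
               / ereal (\<Sum>j=i..n. (\<sigma>_lo j)\<^sup>2)))"
proof (intro conjI allI impI; elim conjE)
  interpret sublinear_expectation_space M P \<Theta>
    by (rule sublinear_expectation_space.intro) (use assms(1-3) in auto)
  fix B \<phi>
  {
    assume "B = sqrt (\<Sum>i=1..n. (\<sigma>_up i)\<^sup>2)" "B > 0" "\<phi> \<in> lip" "convex_on UNIV \<phi>"
    \<comment> \<open>With \<open>c = \<sigma>_up\<close> the mixed term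
      \<open>2 * c\<^sup>2 * \<sigma>_up\<close> is the cube in the claim.\<close>
    with normal_approximation_bound[OF assms(4-7,8,10), where c = \<sigma>_up and \<epsilon> = 1 and B = B and \<phi> = \<phi> and N = N and Z = Z]
      assms(8,10,12,13)
    show "\<bar>sublin_expectation P \<Theta> (\<lambda>\<omega>. \<phi> ((\<Sum>i=1..n. X i \<omega> - \<mu>) / B))
          - ereal (prob_space.expectation N (\<lambda>\<omega>. \<phi> (Z \<omega>)))\<bar>
       \<le> ereal (lip_const \<phi> / B) *
          (\<Sum>i=1..n.
             (ereal (2 * (\<sigma>_up i)^3) + sublin_expectation P \<Theta> (\<lambda>\<omega>. \<bar>X i \<omega> - \<mu>\<bar>^3))
               / ereal (\<Sum>j=i..n. (\<sigma>_up j)\<^sup>2))"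
      by (simp add: power2_eq_square power3_eq_cube mult.assoc)
  next
    assume B: "B = sqrt (\<Sum>i=1..n. (\<sigma>_lo i)\<^sup>2)" "B > 0" and \<phi>: "\<phi> \<in> lip" "concave_on UNIV \<phi>"
    \<comment> \<open>The lower variance, put into the shape required for \<epsilon> = -1.\<close>
    have lo: "sublin_expectation P \<Theta> (\<lambda>\<omega>. - 1 * (X i \<omega> - \<mu>)\<^sup>2) = ereal (- 1 * (\<sigma>_lo i)\<^sup>2)"
      if "i \<in> {1..n}" for i
      using assms(11)[OF that] by (simp add: ereal_uminus_eq_reorder)
    have conv: "convex_on UNIV (\<lambda>x. - 1 * \<phi> x)" using \<phi>(2) by (simp add: concave_on_def)
    show "\<bar>sublin_expectation P \<Theta> (\<lambda>\<omega>. \<phi> ((\<Sum>i=1..n. X i \<omega> - \<mu>) / B))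
          - ereal (prob_space.expectation N (\<lambda>\<omega>. \<phi> (Z \<omega>)))\<bar>
       \<le> ereal (lip_const \<phi> / B) *
          (\<Sum>i=1..n.
             (ereal (2 * (\<sigma>_lo i)\<^sup>2 * \<sigma>_up i) + sublin_expectation P \<Theta> (\<lambda>\<omega>. \<bar>X i \<omega> - \<mu>\<bar>^3))
               / ereal (\<Sum>j=i..n. (\<sigma>_lo j)\<^sup>2))"
      by (rule normal_approximation_bound[OF assms(4-7,8,10,9) lo disjI2[OF refl] assms(12,13) B \<phi>(1) conv])
  }
qed

end
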